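(* The language SPARQAL is Turing-complete. That is, for every Turing machine $M$ over an alphabet $\Sigma$ there exist a SPARQAL procedure $P$ and a computable function $f$, mapping each word in $\Sigma^*$ to an RDF graph, such that for every word $w\in\Sigma^*$: $M$ accepts $w$ if and only if the evaluation of $P$ over the graph $f(w)$ produces a non-empty result.
   Context: **Base language.** SPARQL 1.1 with its standard syntax and semantics in terms of mappings. A mapping is a partial function from query variables (written $?x$) to RDF terms. The result of a SELECT query on an RDF graph is a solution sequence, i.e. a sequence of mappings. The result of an ASK query is true or false. All of SPARQL 1.1 is available, including BIND expressions and arithmetic/algebraic functions that create new values. There is no bound on the memory used for evaluation. **Syntax of SPARQAL.** Besides query variables there are *solution variables* (names), which hold solution sequences. Statements are of three kinds. 1. Assignment: $\texttt{LET var = (Q);}$ where $Q$ is a SPARQL SELECT query that may use constructs $\texttt{QVALUES(var')}$ as subqueries, $\texttt{var'}$ being a solution variable. 2. Loop: $\texttt{DO (S) WHILE (condition);}$ where $S$ is a sequence of statements and the condition is a termination condition of one of the forms - $\texttt{TIMES t}$, with $t>0$ an integer; - $\texttt{FIXPOINT(var)}$, with $\texttt{var}$ a solution variable; - $AQ$, an ASK query that may use constructs $\texttt{QVALUES(var)}$ as subqueries. 3. Return: $\texttt{RETURN(var);}$ where $\texttt{var}$ is a solution variable. A *SPARQAL procedure* is a sequence of statements such that the last statement is a return statement and no other (possibly nested) statement is a return statement, and such that every solution variable used in QVALUES, FIXPOINT or RETURN has been assigned by LET in a previous statement (or a statement nested in a previous statement). **Semantics.** Fix an RDF graph $G$ on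 which all queries are evaluated. Let $s_1;\dots;s_n$ be a sequence of statements mentioning solution variables $\texttt{var}_1,\dots,\texttt{var}_k$ (including in nested statements; variables have global scope). Given an initial $k$-tuple $\mathrm{val}_0$ of (possibly empty) solution sequences, define $\mathrm{val}_i$, the values of the variables after executing $s_i$, inductively. Let $\mathrm{val}_{i-1}=(r_1,\dots,r_k)$. - If $s_i$ is $\texttt{LET var}_j\texttt{ = (Q)}$: let $Q[(\texttt{var}_1,\dots,\texttt{var}_k)\mapsto(r_1,\dots,r_k)]$ be $Q$ with each subquery $\texttt{QVALUES(var}_m\texttt{)}$ replaced by the solution sequence $r_m$ (as with an inline SPARQL VALUES block). Let $r^*$ be the result of evaluating this query over $G$. Then $\mathrm{val}_i$ is $\mathrm{val}_{i-1}$ with its $j$-th component replaced by $r^*$. - If $s_i$ is $\texttt{RETURN(var}_j\texttt{)}$: the procedure terminates and returns the current value $r_j$ of $\texttt{var}_j$. - If $s_i$ is $\texttt{DO (S) WHILE (condition)}$: set $\mathrm{val}'_0:=\mathrm{val}_{i-1}$. Execute the statements of $S$ in order starting from $\mathrm{val}'_0$, obtaining $\mathrm{val}'_\ell$. If the condition is not satisfied, set $\mathrm{val}'_0:=\mathrm{val}'_\ell$ and execute $S$ again. If it is satisfied, stop and set $\mathrm{val}_i:=\mathrm{val}'_\ell$. Here $\texttt{TIMES t}$ is satisfied once $S$ has been executed $t$ times; $\texttt{FIXPOINT(var}_j\texttt{)}$ is satisfied when the $j$-th components of $\mathrm{val}'_\ell$ and $\mathrm{val}'_0$ contain the same set of solutions;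 $AQ$ is satisfied when $AQ[(\texttt{var}_1,\dots,\texttt{var}_k)\mapsto\mathrm{val}'_\ell]$ evaluates to true over $G$. A procedure is evaluated starting with all solution variables empty. An evaluation that never terminates produces no result (in particular, not a non-empty one). *)

theory Defs
  imports Main "HOL-Library.Multiset" "HOL-Library.Char_ord"
begin

section \<open>RDF\<close>

type_synonym iri = string

datatype rdf_term =
    IRI iri
  | BNode nat
  | Literal (lexical: string) (datatype_iri: iri)
  | LangLiteral (lexical: string) (lang_tag: string)

type_synonym triple = "rdf_term \<times> rdf_term \<times> rdf_term"
type_synonym rdf_graph = "triple set"

definition lower :: "char set" where "lower = {CHR ''a''..CHR ''z''}"
definition upper :: "char set" where "upper = {CHR ''A''..CHR ''Z''}"
definition digits :: "char set" where "digits = {CHR ''0''..CHR ''9''}"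

text \<open>Absolute IRIs: a scheme, a colon, and a rest that avoids the characters excluded by the
  \<open>IRIREF\<close> production of SPARQL and N-Triples (controls, blank, and the nine code points listed).\<close>

definition iri_ok :: "iri \<Rightarrow> bool" where
  "iri_ok i \<longleftrightarrow> (\<exists>c s r. i = c # s @ '':'' @ r \<and> c \<in> lower \<union> upper \<and>
     set s \<subseteq> lower \<union> upper \<union> digits \<union> {CHR ''+'', CHR ''-'', CHR ''.''} \<and>
     (\<forall>x\<in>set r. x > CHR 0x20 \<and> x \<notin> {CHR ''<'', CHR ''>'', CHR 0x22, CHR 0x7B, CHR 0x7D,
        CHR 0x7C, CHR 0x5E, CHR 0x60, CHR 0x5C}))"

text \<open>Language tags are kept in lower case, which RDF 1.1 permits.\<close>

definition lang_ok :: "string \<Rightarrow> bool" where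
  "lang_ok l \<longleftrightarrow> (\<exists>p ps. l = p @ concat (map (\<lambda>s. CHR ''-'' # s) ps) \<and> p \<noteq> [] \<and>
     set p \<subseteq> lower \<and> (\<forall>s\<in>set ps. s \<noteq> [] \<and> set s \<subseteq> lower \<union> digits))"

definition rdf_lang_string :: iri where
  "rdf_lang_string = ''http://www.w3.org/1999/02/22-rdf-syntax-ns#langString''"

definition xsd :: "string \<Rightarrow> iri" where
  "xsd s = ''http://www.w3.org/2001/XMLSchema#'' @ s"

fun wf_term :: "rdf_term \<Rightarrow> bool" where
  "wf_term (IRI i) = iri_ok i"
| "wf_term (BNode n) = True"
| "wf_term (Literal s d) = (iri_ok d \<and> d \<noteq> rdf_lang_string)"
| "wf_term (LangLiteral s l) = lang_ok l"

fun is_iri :: "rdf_term \<Rightarrow> bool" where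
  "is_iri (IRI i) = True" | "is_iri _ = False"

fun is_bnode :: "rdf_term \<Rightarrow> bool" where
  "is_bnode (BNode n) = True" | "is_bnode _ = False"

definition is_literal :: "rdf_term \<Rightarrow> bool" where
  "is_literal t \<longleftrightarrow> \<not> is_iri t \<and> \<not> is_bnode t"

definition is_rdf_graph :: "rdf_graph \<Rightarrow> bool" where
  "is_rdf_graph G \<longleftrightarrow> finite G \<and>
     (\<forall>(s, p, obj)\<in>G. wf_term s \<and> wf_term p \<and> wf_term obj \<and> \<not> is_literal s \<and> is_iri p)"

definition nodes :: "rdf_graph \<Rightarrow> rdf_term set" where
  "nodes G = (\<Union>(s, p, obj)\<in>G. {s, obj})"


section \<open>Values, operators and built-in functions\<close>

fun show_nat :: "nat \<Rightarrow> string" where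
  "show_nat n = (if n < 10 then [char_of (48 + n)]
                 else show_nat (n div 10) @ [char_of (48 + n mod 10)])"

declare show_nat.simps [simp del]

definition show_int :: "int \<Rightarrow> string" where
  "show_int i = (if i < 0 then CHR ''-'' # show_nat (nat (- i)) else show_nat (nat i))"

definition parse_nat :: "string \<Rightarrow> nat option" where
  "parse_nat s = (if s \<noteq> [] \<and> set s \<subseteq> digits
     then Some (foldl (\<lambda>n c. 10 * n + (of_char c - 48)) 0 s) else None)"

fun parse_int :: "string \<Rightarrow> int option" where
  "parse_int [] = None"
| "parse_int (c # s) =
     (if c = CHR ''-'' then map_option (\<lambda>n. - int n) (parse_nat s)
      else if c = CHR ''+'' then map_option int (parse_nat s)
      else map_option int (parse_nat (c # s)))"

datatype "value" = VInt int | VStr string | VBool bool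

fun value_of :: "rdf_term \<Rightarrow> value option" where
  "value_of (Literal s d) =
     (if d = xsd ''integer'' then map_option VInt (parse_int s)
      else if d = xsd ''string'' then Some (VStr s)
      else if d = xsd ''boolean'' then
        (if s \<in> {''true'', ''1''} then Some (VBool True)
         else if s \<in> {''false'', ''0''} then Some (VBool False) else None)
      else None)"
| "value_of _ = None"

definition int_lit :: "int \<Rightarrow> rdf_term" where
  "int_lit i = Literal (show_int i) (xsd ''integer'')"
definition str_lit :: "string \<Rightarrow> rdf_term" where
  "str_lit s = Literal s (xsd ''string'')"
definition bool_lit :: "bool \<Rightarrow> rdf_term" where
  "bool_lit b = Literal (if b then ''true'' else ''false'') (xsd ''boolean'')"

definition numeric_datatypes :: "iri set" where
  "numeric_datatypes = xsd ` {''integer'', ''decimal'', ''float'', ''double'',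
     ''nonPositiveInteger'', ''negativeInteger'', ''long'', ''int'', ''short'', ''byte'',
     ''nonNegativeInteger'', ''unsignedLong'', ''unsignedInt'', ''unsignedShort'',
     ''unsignedByte'', ''positiveInteger''}"

definition str_less :: "string \<Rightarrow> string \<Rightarrow> bool" where
  "str_less s s' \<longleftrightarrow> (s, s') \<in> lexord {(a, b). a < b}"

fun compare_values :: "value \<Rightarrow> value \<Rightarrow> int option" where
  "compare_values (VInt i) (VInt j) = Some (sgn (i - j))"
| "compare_values (VStr s) (VStr s') = Some (if s = s' then 0 else if str_less s s' then -1 else 1)"
| "compare_values (VBool b) (VBool b') = Some (if b = b' then 0 else if b' then -1 else 1)"
| "compare_values _ _ = None"

definition compare_terms :: "rdf_term \<Rightarrow> rdf_term \<Rightarrow> int option" where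
  "compare_terms a b = Option.bind (value_of a) (\<lambda>v. Option.bind (value_of b) (compare_values v))"

definition lift_int2 :: "(int \<Rightarrow> int \<Rightarrow> int) \<Rightarrow> rdf_term \<Rightarrow> rdf_term \<Rightarrow> rdf_term option" where
  "lift_int2 f a b = (case (value_of a, value_of b) of
     (Some (VInt i), Some (VInt j)) \<Rightarrow> Some (int_lit (f i j)) | _ \<Rightarrow> None)"

text \<open>RDFterm-equal (used by \<open>=\<close> when no value comparison applies) is an error on two distinct
  literals.  Identical literals of other datatypes are left to the interpretation of the remaining
  operators below, since e.g. NaN of type xsd:double differs from itself.\<close>

definition equal_core :: "rdf_term \<Rightarrow> rdf_term \<Rightarrow> bool option" where
  "equal_core a b = (case compare_terms a b of
     Some c \<Rightarrow> Some (c = 0)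
   | None \<Rightarrow> if is_literal a \<and> is_literal b
             then (case a of LangLiteral _ _ \<Rightarrow> if a = b then Some True else None | _ \<Rightarrow> None)
             else Some (a = b))"

text \<open>String literals of SPARQL: plain (xsd:string) or language-tagged; string functions keep the
  kind of their first argument.\<close>

fun is_string_lit :: "rdf_term \<Rightarrow> bool" where
  "is_string_lit (Literal s d) = (d = xsd ''string'')"
| "is_string_lit (LangLiteral s l) = True"
| "is_string_lit _ = False"

fun same_kind :: "rdf_term \<Rightarrow> string \<Rightarrow> rdf_term" where
  "same_kind (LangLiteral _ l) s = LangLiteral s l"
| "same_kind _ s = str_lit s"

definition str_compatible :: "rdf_term \<Rightarrow> rdf_term \<Rightarrow> bool" where
  "str_compatible a b \<longleftrightarrow> is_string_lit a \<and> is_string_lit b \<and>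
     (b = str_lit (lexical b) \<or> same_kind a [] = same_kind b [])"

definition find_sub :: "string \<Rightarrow> string \<Rightarrow> nat option" where
  "find_sub s p = (let occ = (\<lambda>i. i \<le> length s \<and> take (length p) (drop i s) = p) in
     if \<exists>i. occ i then Some (LEAST i. occ i) else None)"

datatype op =
    OpAdd | OpSub | OpMul | OpDiv | OpUMinus
  | OpEq | OpNeq | OpLess | OpLessEq | OpGreater | OpGreaterEq
  | OpSameTerm | OpIsIRI | OpIsBlank | OpIsLiteral | OpIsNumeric
  | OpStr | OpLang | OpDatatype | OpToIRI | OpStrDt | OpStrLang
  | OpStrLen | OpSubStr | OpStrStarts | OpStrEnds | OpContains | OpStrBefore | OpStrAfter
  | OpConcat | OpAbs
  | OpOther string

fun op_unary :: "op \<Rightarrow> rdf_term \<Rightarrow> rdf_term option" where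
  "op_unary OpUMinus a = lift_int2 (-) (int_lit 0) a"
| "op_unary OpAbs a = lift_int2 (\<lambda>_ i. \<bar>i\<bar>) a a"
| "op_unary OpIsIRI a = Some (bool_lit (is_iri a))"
| "op_unary OpIsBlank a = Some (bool_lit (is_bnode a))"
| "op_unary OpIsLiteral a = Some (bool_lit (is_literal a))"
| "op_unary OpIsNumeric a = (case a of
     Literal s d \<Rightarrow>
       if d \<in> numeric_datatypes - {xsd ''integer''} then None
       else Some (bool_lit (d = xsd ''integer'' \<and> parse_int s \<noteq> None))
   | _ \<Rightarrow> Some (bool_lit False))"
| "op_unary OpStr a = (case a of IRI i \<Rightarrow> Some (str_lit i) | BNode _ \<Rightarrow> None | _ \<Rightarrow> Some (str_lit (lexical a)))"
| "op_unary OpLang a = (case a of LangLiteral _ l \<Rightarrow> Some (str_lit l) | Literal _ _ \<Rightarrow> Some (str_lit []) | _ \<Rightarrow> None)"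
| "op_unary OpDatatype a = (case a of LangLiteral _ _ \<Rightarrow> Some (IRI rdf_lang_string) | Literal _ d \<Rightarrow> Some (IRI d) | _ \<Rightarrow> None)"
| "op_unary OpToIRI a = (case a of
     IRI i \<Rightarrow> Some a
   | Literal s d \<Rightarrow> if d = xsd ''string'' \<and> iri_ok s then Some (IRI s) else None
   | _ \<Rightarrow> None)"
| "op_unary OpStrLen a =
     (if is_string_lit a then Some (int_lit (int (length (lexical a)))) else None)"
| "op_unary _ a = None"

fun op_binary :: "op \<Rightarrow> rdf_term \<Rightarrow> rdf_term \<Rightarrow> rdf_term option" where
  "op_binary OpAdd a b = lift_int2 (+) a b"
| "op_binary OpSub a b = lift_int2 (-) a b"
| "op_binary OpMul a b = lift_int2 (*) a b"
| "op_binary OpEq a b = map_option bool_lit (equal_core a b)"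
| "op_binary OpNeq a b = map_option (\<lambda>c. bool_lit (\<not> c)) (equal_core a b)"
| "op_binary OpLess a b = map_option (\<lambda>c. bool_lit (c < 0)) (compare_terms a b)"
| "op_binary OpLessEq a b = map_option (\<lambda>c. bool_lit (c \<le> 0)) (compare_terms a b)"
| "op_binary OpGreater a b = map_option (\<lambda>c. bool_lit (c > 0)) (compare_terms a b)"
| "op_binary OpGreaterEq a b = map_option (\<lambda>c. bool_lit (c \<ge> 0)) (compare_terms a b)"
| "op_binary OpSameTerm a b = Some (bool_lit (a = b))"
| "op_binary OpStrDt a b = (case (value_of a, b) of
     (Some (VStr s), IRI d) \<Rightarrow> if d \<noteq> rdf_lang_string then Some (Literal s d) else None
   | _ \<Rightarrow> None)"
| "op_binary OpStrLang a b = (case (value_of a, value_of b) of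
     (Some (VStr s), Some (VStr l)) \<Rightarrow> if lang_ok l then Some (LangLiteral s l) else None
   | _ \<Rightarrow> None)"
| "op_binary OpSubStr a b = (case value_of b of
     Some (VInt i) \<Rightarrow> if is_string_lit a
       then Some (same_kind a (nths (lexical a) {k. i \<le> int k + 1})) else None
   | _ \<Rightarrow> None)"
| "op_binary OpStrStarts a b = (if str_compatible a b
     then Some (bool_lit (\<exists>s. lexical a = lexical b @ s)) else None)"
| "op_binary OpStrEnds a b = (if str_compatible a b
     then Some (bool_lit (\<exists>s. lexical a = s @ lexical b)) else None)"
| "op_binary OpContains a b = (if str_compatible a b
     then Some (bool_lit (find_sub (lexical a) (lexical b) \<noteq> None)) else None)"
| "op_binary OpStrBefore a b = (if str_compatible a b
     then Some (case find_sub (lexical a) (lexical b) of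
        None \<Rightarrow> str_lit [] | Some i \<Rightarrow> same_kind a (take i (lexical a))) else None)"
| "op_binary OpStrAfter a b = (if str_compatible a b
     then Some (case find_sub (lexical a) (lexical b) of
        None \<Rightarrow> str_lit [] | Some i \<Rightarrow> same_kind a (drop (i + length (lexical b)) (lexical a))) else None)"
| "op_binary _ a b = None"

definition substr3 :: "rdf_term \<Rightarrow> rdf_term \<Rightarrow> rdf_term \<Rightarrow> rdf_term option" where
  "substr3 a b c = (case (value_of b, value_of c) of
     (Some (VInt i), Some (VInt n)) \<Rightarrow> if is_string_lit a
       then Some (same_kind a (nths (lexical a) {k. i \<le> int k + 1 \<and> int k + 1 < i + n})) else None
   | _ \<Rightarrow> None)"

definition concat_lits :: "rdf_term list \<Rightarrow> rdf_term option" where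
  "concat_lits as = (if \<forall>a\<in>set as. is_string_lit a
     then let s = concat (map lexical as) in
       Some (if as \<noteq> [] \<and> (\<forall>a\<in>set as. same_kind a [] = same_kind (hd as) [])
             then same_kind (hd as) s else str_lit s)
     else None)"

definition op_core :: "op \<Rightarrow> rdf_term list \<Rightarrow> rdf_term option" where
  "op_core f as = (if f = OpConcat then concat_lits as else (case as of
     [a] \<Rightarrow> op_unary f a
   | [a, b] \<Rightarrow> op_binary f a b
   | [a, b, c] \<Rightarrow> if f = OpSubStr then substr3 a b c else None
   | _ \<Rightarrow> None))"

text \<open>SPARQL's operator table is large (decimals, floating point, dates, regular expressions,
  hashes, casts, extension functions, ...).  What is not covered by \<^const>\<open>op_core\<close> is delegated to an
  interpretation \<open>X\<close>, which is a parameter of the semantics; \<open>None\<close> stands for an error.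
  \<open>OpOther\<close> names the functions and casts for which \<^const>\<open>op_core\<close> has no case at all.\<close>

type_synonym op_interp = "op \<Rightarrow> rdf_term list \<Rightarrow> rdf_term option"

definition apply_op :: "op_interp \<Rightarrow> op_interp" where
  "apply_op X f as = (case op_core f as of Some r \<Rightarrow> Some r | None \<Rightarrow> X f as)"

text \<open>Effective boolean value.  \<open>X (OpOther ''EBV'')\<close> supplies it for literals outside the core.\<close>

fun ebv :: "op_interp \<Rightarrow> rdf_term \<Rightarrow> bool option" where
  "ebv X (LangLiteral s l) = Some (s \<noteq> [])"
| "ebv X (Literal s d) = (case value_of (Literal s d) of
     Some (VInt i) \<Rightarrow> Some (i \<noteq> 0)
   | Some (VStr s') \<Rightarrow> Some (s' \<noteq> [])
   | Some (VBool b) \<Rightarrow> Some b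
   | None \<Rightarrow> if d \<in> {xsd ''integer'', xsd ''boolean''} then Some False
             else (case X (OpOther ''EBV'') [Literal s d] of
                     Some t \<Rightarrow> (case value_of t of Some (VBool b) \<Rightarrow> Some b | _ \<Rightarrow> None)
                   | None \<Rightarrow> None))"
| "ebv X _ = None"

definition ebv_opt :: "op_interp \<Rightarrow> rdf_term option \<Rightarrow> bool option" where
  "ebv_opt X r = Option.bind r (ebv X)"

definition holds :: "op_interp \<Rightarrow> rdf_term option \<Rightarrow> bool" where
  "holds X r \<longleftrightarrow> ebv_opt X r = Some True"

definition or3 :: "bool option \<Rightarrow> bool option \<Rightarrow> bool option" where
  "or3 a b = (if a = Some True \<or> b = Some True then Some True
              else if a = None \<or> b = None then None else Some False)"

definition not3 :: "bool option \<Rightarrow> bool option" where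
  "not3 a = map_option Not a"

definition and3 :: "bool option \<Rightarrow> bool option \<Rightarrow> bool option" where
  "and3 a b = not3 (or3 (not3 a) (not3 b))"

definition apply_strict :: "op_interp \<Rightarrow> op \<Rightarrow> rdf_term option list \<Rightarrow> rdf_term option" where
  "apply_strict X f rs = Option.bind (those rs) (apply_op X f)"


section \<open>Syntax of SPARQL queries\<close>

text \<open>Abstract syntax at the level of the SPARQL algebra; each form is written in concrete syntax
  with nested group patterns.  A SELECT item \<open>(e AS ?v)\<close> is \<open>PBind\<close> under the projection, and HAVING
  is \<open>PFilter\<close> over \<open>PGroup\<close>.  Blank nodes in queries are just non-projected variables and
  are therefore left out.  The type parameter is the type of solution variables, and the set
  functions \<open>svars_of_pattern\<close> etc. give those occurring in \<open>PQValues\<close>.\<close>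

type_synonym var = string
type_synonym mapping = "var \<rightharpoonup> rdf_term"

datatype tv = V var | T rdf_term

type_synonym triple_pattern = "tv \<times> tv \<times> tv"

datatype path =
    Link iri
  | NegatedSet "iri list"
  | Inverse path
  | Sequence path path
  | Alternative path path
  | ZeroOrOne path
  | ZeroOrMore path
  | OneOrMore path

datatype set_function = Count | Sum | Avg | Minimum | Maximum | Sample | GroupConcat string

datatype (svars_of_expr: 'n) expr =
    EVar var
  | ETerm rdf_term
  | ENot "'n expr"
  | EOr "'n expr" "'n expr"
  | EAnd "'n expr" "'n expr"
  | EBound var
  | EIf "'n expr" "'n expr" "'n expr"
  | ECoalesce "'n expr list"
  | EIn "'n expr" "'n expr list"
  | EExists "'n pattern"
  | EApply op "'n expr list"
and (svars_of_pattern: 'n) pattern =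
    PBgp "triple_pattern list"
  | PPath tv path tv
  | PJoin "'n pattern" "'n pattern"
  | PLeftJoin "'n pattern" "'n pattern" "'n expr"  \<comment> \<open>\<open>P\<^sub>1 OPTIONAL {P\<^sub>2 FILTER e}\<close>\<close>
  | PUnion "'n pattern" "'n pattern"
  | PMinus "'n pattern" "'n pattern"
  | PFilter "'n expr" "'n pattern"
  | PBind "'n pattern" var "'n expr"
  | PValues "var list" "rdf_term option list list"  \<comment> \<open>\<open>None\<close> is \<open>UNDEF\<close>\<close>
  | PQValues 'n
  | PSubSelect "'n select"
  | PGroup "'n pattern" "var list" "var list" "'n aggregate list"
      \<comment> \<open>grouping keys, then the aggregates with the variables that receive their values\<close>
and (svars_of_aggregate: 'n) aggregate =
    CountAll bool
  | Aggregate set_function bool "'n expr"  \<comment> \<open>the flag is \<open>DISTINCT\<close>\<close>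
and (svars_of_order: 'n) order_condition =
    Asc "'n expr"
  | Desc "'n expr"
and (svars_of_select: 'n) select =
    Select (distinct_flag: bool) (projection: "var list") "'n pattern"
      "'n order_condition list" nat "nat option"  \<comment> \<open>\<open>ORDER BY\<close>, \<open>OFFSET\<close>, \<open>LIMIT\<close>\<close>

subsection \<open>Well-formedness\<close>

fun vars_tv :: "tv \<Rightarrow> var set" where
  "vars_tv (V v) = {v}" | "vars_tv (T t) = {}"

fun vars_tp :: "triple_pattern \<Rightarrow> var set" where
  "vars_tp (a, b, c) = vars_tv a \<union> vars_tv b \<union> vars_tv c"

fun wf_tv :: "tv \<Rightarrow> bool" where
  "wf_tv (V v) = True" | "wf_tv (T t) = (wf_term t \<and> \<not> is_bnode t)"

fun wf_tp :: "triple_pattern \<Rightarrow> bool" where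
  "wf_tp (a, b, c) = (wf_tv a \<and> wf_tv b \<and> wf_tv c \<and> (\<forall>t. b = T t \<longrightarrow> is_iri t))"

fun wf_path :: "path \<Rightarrow> bool" where
  "wf_path (Link i) = iri_ok i"
| "wf_path (NegatedSet is) = (\<forall>i\<in>set is. iri_ok i)"
| "wf_path (Inverse p) = wf_path p"
| "wf_path (Sequence p q) = (wf_path p \<and> wf_path q)"
| "wf_path (Alternative p q) = (wf_path p \<and> wf_path q)"
| "wf_path (ZeroOrOne p) = wf_path p"
| "wf_path (ZeroOrMore p) = wf_path p"
| "wf_path (OneOrMore p) = wf_path p"

text \<open>In-scope variables; \<open>sch\<close> gives the variables that may occur in the value of a
  solution variable.\<close>

primrec in_scope :: "('n \<Rightarrow> var set) \<Rightarrow> 'n pattern \<Rightarrow> var set" where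
  "in_scope sch (PBgp tps) = (\<Union>tp\<in>set tps. vars_tp tp)"
| "in_scope sch (PPath s p t) = vars_tv s \<union> vars_tv t"
| "in_scope sch (PJoin P Q) = in_scope sch P \<union> in_scope sch Q"
| "in_scope sch (PLeftJoin P Q e) = in_scope sch P \<union> in_scope sch Q"
| "in_scope sch (PUnion P Q) = in_scope sch P \<union> in_scope sch Q"
| "in_scope sch (PMinus P Q) = in_scope sch P"
| "in_scope sch (PFilter e P) = in_scope sch P"
| "in_scope sch (PBind P v e) = insert v (in_scope sch P)"
| "in_scope sch (PValues vs rows) = set vs"
| "in_scope sch (PQValues x) = sch x"
| "in_scope sch (PSubSelect q) = set (projection q)"
| "in_scope sch (PGroup P keys vs as) = set keys \<union> set vs"

primrec wf_expr :: "('n \<Rightarrow> var set) \<Rightarrow> 'n expr \<Rightarrow> bool"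
  and wf_pattern :: "('n \<Rightarrow> var set) \<Rightarrow> 'n pattern \<Rightarrow> bool"
  and wf_aggregate :: "('n \<Rightarrow> var set) \<Rightarrow> 'n aggregate \<Rightarrow> bool"
  and wf_order :: "('n \<Rightarrow> var set) \<Rightarrow> 'n order_condition \<Rightarrow> bool"
  and wf_select :: "('n \<Rightarrow> var set) \<Rightarrow> 'n select \<Rightarrow> bool" where
  "wf_expr sch (EVar v) = True"
| "wf_expr sch (ETerm t) = (wf_term t \<and> \<not> is_bnode t)"
| "wf_expr sch (ENot e) = wf_expr sch e"
| "wf_expr sch (EOr e e') = (wf_expr sch e \<and> wf_expr sch e')"
| "wf_expr sch (EAnd e e') = (wf_expr sch e \<and> wf_expr sch e')"
| "wf_expr sch (EBound v) = True"
| "wf_expr sch (EIf e1 e2 e3) = (wf_expr sch e1 \<and> wf_expr sch e2 \<and> wf_expr sch e3)"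
| "wf_expr sch (ECoalesce es) = list_all (\<lambda>b. b) (map (wf_expr sch) es)"
| "wf_expr sch (EIn e es) = (wf_expr sch e \<and> list_all (\<lambda>b. b) (map (wf_expr sch) es))"
| "wf_expr sch (EExists P) = wf_pattern sch P"
| "wf_expr sch (EApply f es) = list_all (\<lambda>b. b) (map (wf_expr sch) es)"
| "wf_pattern sch (PBgp tps) = (\<forall>tp\<in>set tps. wf_tp tp)"
| "wf_pattern sch (PPath s p t) = (wf_tv s \<and> wf_path p \<and> wf_tv t)"
| "wf_pattern sch (PJoin P Q) = (wf_pattern sch P \<and> wf_pattern sch Q)"
| "wf_pattern sch (PLeftJoin P Q e) = (wf_pattern sch P \<and> wf_pattern sch Q \<and> wf_expr sch e)"
| "wf_pattern sch (PUnion P Q) = (wf_pattern sch P \<and> wf_pattern sch Q)"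
| "wf_pattern sch (PMinus P Q) = (wf_pattern sch P \<and> wf_pattern sch Q)"
| "wf_pattern sch (PFilter e P) = (wf_expr sch e \<and> wf_pattern sch P)"
| "wf_pattern sch (PBind P v e) = (wf_pattern sch P \<and> wf_expr sch e \<and> v \<notin> in_scope sch P)"
| "wf_pattern sch (PValues vs rows) = (distinct vs \<and> (\<forall>row\<in>set rows. length row = length vs \<and>
     (\<forall>t. Some t \<in> set row \<longrightarrow> wf_term t \<and> \<not> is_bnode t)))"
| "wf_pattern sch (PQValues x) = True"
| "wf_pattern sch (PSubSelect q) = wf_select sch q"
| "wf_pattern sch (PGroup P keys vs as) = (wf_pattern sch P \<and> distinct vs \<and>
     length vs = length as \<and> set vs \<inter> (set keys \<union> in_scope sch P) = {} \<and>
     list_all (\<lambda>b. b) (map (wf_aggregate sch) as))"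
| "wf_aggregate sch (CountAll d) = True"
| "wf_aggregate sch (Aggregate f d e) = wf_expr sch e"
| "wf_order sch (Asc e) = wf_expr sch e"
| "wf_order sch (Desc e) = wf_expr sch e"
| "wf_select sch (Select d vs P os off lim) =
     (vs \<noteq> [] \<and> wf_pattern sch P \<and> list_all (\<lambda>b. b) (map (wf_order sch) os))"


section \<open>Semantics of SPARQL queries\<close>

text \<open>The order of a solution sequence that is not fixed by \<open>ORDER BY\<close> is implementation-dependent;
  it is an unspecified choice here.\<close>

definition to_list :: "'a multiset \<Rightarrow> 'a list" where
  "to_list A = (SOME xs. mset xs = A)"

definition compatible :: "mapping \<Rightarrow> mapping \<Rightarrow> bool" where
  "compatible \<mu> \<nu> \<longleftrightarrow> (\<forall>v\<in>dom \<mu> \<inter> dom \<nu>. \<mu> v = \<nu> v)"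

definition pairs :: "'a multiset \<Rightarrow> 'b multiset \<Rightarrow> ('a \<times> 'b) multiset" where
  "pairs A B = sum_mset {# {# (a, b). b \<in># B #}. a \<in># A #}"

definition join :: "mapping multiset \<Rightarrow> mapping multiset \<Rightarrow> mapping multiset" where
  "join A B = {# \<mu> ++ \<nu>. (\<mu>, \<nu>) \<in># filter_mset (\<lambda>(\<mu>, \<nu>). compatible \<mu> \<nu>) (pairs A B) #}"

definition diff :: "(mapping \<Rightarrow> bool) \<Rightarrow> mapping multiset \<Rightarrow> mapping multiset \<Rightarrow> mapping multiset" where
  "diff c A B = {# \<mu> \<in># A. \<forall>\<nu>\<in>#B. \<not> (compatible \<mu> \<nu> \<and> c (\<mu> ++ \<nu>)) #}"

definition minus :: "mapping multiset \<Rightarrow> mapping multiset \<Rightarrow> mapping multiset" where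
  "minus A B = {# \<mu> \<in># A. \<forall>\<nu>\<in>#B. \<not> compatible \<mu> \<nu> \<or> dom \<mu> \<inter> dom \<nu> = {} #}"

fun inst :: "mapping \<Rightarrow> tv \<Rightarrow> rdf_term" where
  "inst \<mu> (V v) = the (\<mu> v)" | "inst \<mu> (T t) = t"

definition bgp_solutions :: "rdf_graph \<Rightarrow> triple_pattern list \<Rightarrow> mapping set" where
  "bgp_solutions G tps = {\<mu>. dom \<mu> = (\<Union>tp\<in>set tps. vars_tp tp) \<and>
     (\<forall>(a, b, c)\<in>set tps. (inst \<mu> a, inst \<mu> b, inst \<mu> c) \<in> G)}"

text \<open>Property paths: \<open>s\<close>, \<open>t\<close> are the fixed end points, \<open>None\<close> standing for a variable.  The
  result is a multiset of pairs of end points.  As in SPARQL 1.1, zero-length paths from a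
  fixed term exist even if it is not a node of the graph.\<close>

definition ends :: "rdf_term option \<Rightarrow> rdf_term option \<Rightarrow> rdf_term \<times> rdf_term \<Rightarrow> bool" where
  "ends s t p \<longleftrightarrow> s \<in> {None, Some (fst p)} \<and> t \<in> {None, Some (snd p)}"

definition zero_length :: "rdf_graph \<Rightarrow> rdf_term option \<Rightarrow> rdf_term option \<Rightarrow> (rdf_term \<times> rdf_term) set" where
  "zero_length G s t = {p \<in> (\<lambda>x. (x, x)) ` (nodes G \<union> set_option s \<union> set_option t). ends s t p}"

definition closure_pairs :: "rdf_graph \<Rightarrow> (rdf_term option \<Rightarrow> rdf_term option \<Rightarrow> (rdf_term \<times> rdf_term) multiset) \<Rightarrow>
    ((rdf_term \<times> rdf_term) set \<Rightarrow> (rdf_term \<times> rdf_term) set) \<Rightarrow>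
    rdf_term option \<Rightarrow> rdf_term option \<Rightarrow> (rdf_term \<times> rdf_term) set" where
  "closure_pairs G ev cl s t = (case s of
     Some a \<Rightarrow> {(x, y) \<in> cl {(x, y). (x, y) \<in># ev (Some x) None}. x = a \<and> (\<forall>b. t = Some b \<longrightarrow> y = b)}
   | None \<Rightarrow> (case t of
       Some b \<Rightarrow> {(x, y) \<in> cl {(x, y). (x, y) \<in># ev None (Some y)}. y = b}
     | None \<Rightarrow> {(x, y) \<in> cl {(x, y). (x, y) \<in># ev (Some x) None}. x \<in> nodes G}))"

primrec eval_path :: "rdf_graph \<Rightarrow> path \<Rightarrow> rdf_term option \<Rightarrow> rdf_term option \<Rightarrow> (rdf_term \<times> rdf_term) multiset" where
  "eval_path G (Link i) = (\<lambda>s t. mset_set {p. (fst p, IRI i, snd p) \<in> G \<and> ends s t p})"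
| "eval_path G (NegatedSet is) = (\<lambda>s t.
     {# p \<in># {# (x, y). (x, q, y) \<in># mset_set {(x, q, y) \<in> G. q \<notin> IRI ` set is} #}. ends s t p #})"
| "eval_path G (Inverse p) = (\<lambda>s t. image_mset prod.swap (eval_path G p t s))"
| "eval_path G (Sequence p q) = (\<lambda>s t.
     {# (x, y). ((x, z), (z', y)) \<in>#
        filter_mset (\<lambda>((x, z), (z', y)). z = z') (pairs (eval_path G p s None) (eval_path G q None t)) #})"
| "eval_path G (Alternative p q) = (\<lambda>s t. eval_path G p s t + eval_path G q s t)"
| "eval_path G (ZeroOrOne p) = (\<lambda>s t. mset_set (set_mset (eval_path G p s t) \<union> zero_length G s t))"
| "eval_path G (ZeroOrMore p) = (\<lambda>s t. mset_set (closure_pairs G (eval_path G p) rtrancl s t))"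
| "eval_path G (OneOrMore p) = (\<lambda>s t. mset_set (closure_pairs G (eval_path G p) trancl s t))"

text \<open>Evaluation inside \<open>EXISTS\<close> replaces variables by the values \<open>\<sigma>\<close> of the solution being
  filtered; \<open>\<sigma>\<close> is carried along instead of rewriting the pattern.\<close>

fun subst_tv :: "mapping \<Rightarrow> tv \<Rightarrow> tv" where
  "subst_tv \<sigma> (V v) = (case \<sigma> v of Some t \<Rightarrow> T t | None \<Rightarrow> V v)"
| "subst_tv \<sigma> (T t) = T t"

fun subst_tp :: "mapping \<Rightarrow> triple_pattern \<Rightarrow> triple_pattern" where
  "subst_tp \<sigma> (a, b, c) = (subst_tv \<sigma> a, subst_tv \<sigma> b, subst_tv \<sigma> c)"

definition inline_data :: "mapping \<Rightarrow> mapping multiset \<Rightarrow> mapping multiset" where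
  "inline_data \<sigma> A = {# \<mu> |` (- dom \<sigma>). \<mu> \<in># filter_mset (compatible \<sigma>) A #}"

definition row_mapping :: "var list \<Rightarrow> rdf_term option list \<Rightarrow> mapping" where
  "row_mapping vs row = (\<lambda>v. Option.bind (map_of (zip vs row) v) (\<lambda>r. r))"

fun end_point :: "tv \<Rightarrow> rdf_term option" where
  "end_point (V v) = None" | "end_point (T t) = Some t"

fun bind_end :: "tv \<Rightarrow> rdf_term \<Rightarrow> mapping" where
  "bind_end (V v) t = [v \<mapsto> t]" | "bind_end (T _) _ = Map.empty"

definition path_solutions :: "rdf_graph \<Rightarrow> tv \<Rightarrow> path \<Rightarrow> tv \<Rightarrow> mapping multiset" where
  "path_solutions G a p b =
     {# bind_end a x ++ bind_end b y.
        (x, y) \<in># filter_mset (\<lambda>(x, y). compatible (bind_end a x) (bind_end b y))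
                  (eval_path G p (end_point a) (end_point b)) #}"

text \<open>\<open>ORDER BY\<close> and \<open>MIN\<close>/\<open>MAX\<close>: unbound < blank nodes < IRIs < literals, and on literals \<open><\<close>
  where it is defined.  Between literals that \<open><\<close> does not relate SPARQL leaves the order open; they
  are grouped by kind, so that \<open>before\<close> is a strict weak order on the core datatypes.\<close>

fun rank :: "rdf_term option \<Rightarrow> nat" where
  "rank None = 0"
| "rank (Some (BNode _)) = 1"
| "rank (Some (IRI _)) = 2"
| "rank (Some (Literal s d)) = (if d \<in> numeric_datatypes then 3 else if d = xsd ''string'' then 4
      else if d = xsd ''boolean'' then 5 else 6)"
| "rank (Some (LangLiteral _ _)) = 7"

definition before :: "op_interp \<Rightarrow> rdf_term option \<Rightarrow> rdf_term option \<Rightarrow> bool" where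
  "before X a b \<longleftrightarrow> rank a < rank b \<or> rank a = rank b \<and>
     (case (a, b) of
        (Some (IRI i), Some (IRI j)) \<Rightarrow> str_less i j
      | (Some s, Some t) \<Rightarrow> is_literal s \<and> is_literal t \<and> holds X (apply_op X OpLess [s, t])
      | _ \<Rightarrow> False)"

fun before_lex :: "op_interp \<Rightarrow> bool list \<Rightarrow> rdf_term option list \<Rightarrow> rdf_term option list \<Rightarrow> bool" where
  "before_lex X (desc # ds) (a # as) (b # bs) =
     (let a' = (if desc then b else a); b' = (if desc then a else b) in
       before X a' b' \<or> \<not> before X b' a' \<and> before_lex X ds as bs)"
| "before_lex X _ _ _ = False"

fun insert_before :: "('a \<Rightarrow> 'a \<Rightarrow> bool) \<Rightarrow> 'a \<Rightarrow> 'a list \<Rightarrow> 'a list" where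
  "insert_before lt x [] = [x]"
| "insert_before lt x (y # ys) = (if lt y x then y # insert_before lt x ys else x # y # ys)"

definition sort_before :: "('a \<Rightarrow> 'a \<Rightarrow> bool) \<Rightarrow> 'a list \<Rightarrow> 'a list" where
  "sort_before lt xs = foldr (insert_before lt) xs []"

text \<open>Set functions act on the multiset of values of the argument expression, errors included
  as \<open>None\<close>.\<close>

definition sum_values :: "op_interp \<Rightarrow> rdf_term option multiset \<Rightarrow> rdf_term option" where
  "sum_values X A = foldl (\<lambda>s r. apply_strict X OpAdd [s, r]) (Some (int_lit 0)) (to_list A)"

fun eval_set_function :: "op_interp \<Rightarrow> set_function \<Rightarrow> rdf_term option multiset \<Rightarrow> rdf_term option" where
  "eval_set_function X Count A = Some (int_lit (int (size {# r \<in># A. r \<noteq> None #})))"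
| "eval_set_function X Sum A = sum_values X A"
| "eval_set_function X Avg A = (if A = {#} then Some (int_lit 0)
     else apply_strict X OpDiv [sum_values X A, Some (int_lit (int (size A)))])"
| "eval_set_function X Minimum A = (if A = {#} \<or> None \<in># A then None
     else hd (sort_before (before X) (to_list A)))"
| "eval_set_function X Maximum A = (if A = {#} \<or> None \<in># A then None
     else last (sort_before (before X) (to_list A)))"
| "eval_set_function X Sample A = (if \<exists>t. Some t \<in># A then (SOME r. r \<in># A \<and> r \<noteq> None) else None)"
| "eval_set_function X (GroupConcat sep) A =
     map_option (\<lambda>ts. str_lit (concat (case map lexical ts of [] \<Rightarrow> []
         | s # ss \<Rightarrow> s # map (\<lambda>s'. sep @ s') ss)))
       (those (map (\<lambda>r. apply_strict X OpStr [r]) (to_list A)))"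

definition dedup :: "bool \<Rightarrow> 'a multiset \<Rightarrow> 'a multiset" where
  "dedup d A = (if d then mset_set (set_mset A) else A)"

text \<open>Without \<open>GROUP BY\<close> keys there is exactly one group, even for an empty input.\<close>

definition group_solutions ::
  "var list \<Rightarrow> var list \<Rightarrow> (mapping multiset \<Rightarrow> rdf_term option) list \<Rightarrow> mapping multiset \<Rightarrow> mapping multiset" where
  "group_solutions keys vs fs A =
     (let ks = (if keys = [] then {Map.empty} else (\<lambda>\<mu>. \<mu> |` set keys) ` set_mset A) in
      {# row_mapping vs (map (\<lambda>f. f {# \<mu> \<in># A. \<mu> |` set keys = k #}) fs) ++ k. k \<in># mset_set ks #})"

definition slice :: "nat \<Rightarrow> nat option \<Rightarrow> 'a list \<Rightarrow> 'a list" where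
  "slice off lim xs = (case lim of None \<Rightarrow> drop off xs | Some n \<Rightarrow> take n (drop off xs))"

text \<open>The arguments are the interpretation of the remaining operators, the graph, the values of the
  solution variables, the query, and the substitution \<open>\<sigma>\<close> of an enclosing \<open>EXISTS\<close>.  Passing \<open>\<rho>\<close>
  implements the replacement of \<open>QVALUES(x)\<close> by the solution sequence \<open>\<rho> x\<close>.\<close>

primrec eval_expr :: "op_interp \<Rightarrow> rdf_graph \<Rightarrow> ('n \<Rightarrow> mapping list) \<Rightarrow> 'n expr \<Rightarrow> mapping \<Rightarrow> mapping \<Rightarrow> rdf_term option"
  and eval_pattern :: "op_interp \<Rightarrow> rdf_graph \<Rightarrow> ('n \<Rightarrow> mapping list) \<Rightarrow> 'n pattern \<Rightarrow> mapping \<Rightarrow> mapping multiset"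
  and eval_aggregate :: "op_interp \<Rightarrow> rdf_graph \<Rightarrow> ('n \<Rightarrow> mapping list) \<Rightarrow> 'n aggregate \<Rightarrow> mapping \<Rightarrow> mapping multiset \<Rightarrow> rdf_term option"
  and eval_order :: "op_interp \<Rightarrow> rdf_graph \<Rightarrow> ('n \<Rightarrow> mapping list) \<Rightarrow> 'n order_condition \<Rightarrow> mapping \<Rightarrow> mapping \<Rightarrow> bool \<times> rdf_term option"
  and eval_select :: "op_interp \<Rightarrow> rdf_graph \<Rightarrow> ('n \<Rightarrow> mapping list) \<Rightarrow> 'n select \<Rightarrow> mapping \<Rightarrow> mapping list" where
  "eval_expr X G \<rho> (EVar v) = (\<lambda>\<sigma> \<mu>. (\<mu> ++ \<sigma>) v)"
| "eval_expr X G \<rho> (ETerm t) = (\<lambda>\<sigma> \<mu>. Some t)"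
| "eval_expr X G \<rho> (ENot e) = (\<lambda>\<sigma> \<mu>. map_option bool_lit (not3 (ebv_opt X (eval_expr X G \<rho> e \<sigma> \<mu>))))"
| "eval_expr X G \<rho> (EOr e e') = (\<lambda>\<sigma> \<mu>. map_option bool_lit
     (or3 (ebv_opt X (eval_expr X G \<rho> e \<sigma> \<mu>)) (ebv_opt X (eval_expr X G \<rho> e' \<sigma> \<mu>))))"
| "eval_expr X G \<rho> (EAnd e e') = (\<lambda>\<sigma> \<mu>. map_option bool_lit
     (and3 (ebv_opt X (eval_expr X G \<rho> e \<sigma> \<mu>)) (ebv_opt X (eval_expr X G \<rho> e' \<sigma> \<mu>))))"
| "eval_expr X G \<rho> (EBound v) = (\<lambda>\<sigma> \<mu>. Some (bool_lit ((\<mu> ++ \<sigma>) v \<noteq> None)))"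
| "eval_expr X G \<rho> (EIf e1 e2 e3) = (\<lambda>\<sigma> \<mu>. case ebv_opt X (eval_expr X G \<rho> e1 \<sigma> \<mu>) of
       None \<Rightarrow> None
     | Some b \<Rightarrow> if b then eval_expr X G \<rho> e2 \<sigma> \<mu> else eval_expr X G \<rho> e3 \<sigma> \<mu>)"
| "eval_expr X G \<rho> (ECoalesce es) = (\<lambda>\<sigma> \<mu>.
     case filter (\<lambda>r. r \<noteq> None) (map (\<lambda>f. f \<sigma> \<mu>) (map (eval_expr X G \<rho>) es)) of
       [] \<Rightarrow> None | r # _ \<Rightarrow> r)"
| "eval_expr X G \<rho> (EIn e es) = (\<lambda>\<sigma> \<mu>. map_option bool_lit
     (foldr (\<lambda>f. or3 (ebv_opt X (apply_strict X OpEq [eval_expr X G \<rho> e \<sigma> \<mu>, f \<sigma> \<mu>])))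
        (map (eval_expr X G \<rho>) es) (Some False)))"
| "eval_expr X G \<rho> (EExists P) = (\<lambda>\<sigma> \<mu>. Some (bool_lit (eval_pattern X G \<rho> P (\<mu> ++ \<sigma>) \<noteq> {#})))"
| "eval_expr X G \<rho> (EApply f es) = (\<lambda>\<sigma> \<mu>.
     apply_strict X f (map (\<lambda>g. g \<sigma> \<mu>) (map (eval_expr X G \<rho>) es)))"
| "eval_pattern X G \<rho> (PBgp tps) = (\<lambda>\<sigma>. mset_set (bgp_solutions G (map (subst_tp \<sigma>) tps)))"
| "eval_pattern X G \<rho> (PPath s p t) = (\<lambda>\<sigma>. path_solutions G (subst_tv \<sigma> s) p (subst_tv \<sigma> t))"
| "eval_pattern X G \<rho> (PJoin P Q) = (\<lambda>\<sigma>. join (eval_pattern X G \<rho> P \<sigma>) (eval_pattern X G \<rho> Q \<sigma>))"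
| "eval_pattern X G \<rho> (PLeftJoin P Q e) = (\<lambda>\<sigma>.
     (let A = eval_pattern X G \<rho> P \<sigma>; B = eval_pattern X G \<rho> Q \<sigma>;
          c = (\<lambda>\<mu>. holds X (eval_expr X G \<rho> e \<sigma> \<mu>))
      in filter_mset c (join A B) + diff c A B))"
| "eval_pattern X G \<rho> (PUnion P Q) = (\<lambda>\<sigma>. eval_pattern X G \<rho> P \<sigma> + eval_pattern X G \<rho> Q \<sigma>)"
| "eval_pattern X G \<rho> (PMinus P Q) = (\<lambda>\<sigma>. minus (eval_pattern X G \<rho> P \<sigma>) (eval_pattern X G \<rho> Q \<sigma>))"
| "eval_pattern X G \<rho> (PFilter e P) = (\<lambda>\<sigma>.
     {# \<mu> \<in># eval_pattern X G \<rho> P \<sigma>. holds X (eval_expr X G \<rho> e \<sigma> \<mu>) #})"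
| "eval_pattern X G \<rho> (PBind P v e) = (\<lambda>\<sigma>.
     {# \<mu>(v := eval_expr X G \<rho> e \<sigma> \<mu>). \<mu> \<in># eval_pattern X G \<rho> P \<sigma> #})"
| "eval_pattern X G \<rho> (PValues vs rows) = (\<lambda>\<sigma>. inline_data \<sigma> (mset (map (row_mapping vs) rows)))"
| "eval_pattern X G \<rho> (PQValues x) = (\<lambda>\<sigma>. inline_data \<sigma> (mset (\<rho> x)))"
| "eval_pattern X G \<rho> (PSubSelect q) = (\<lambda>\<sigma>. mset (eval_select X G \<rho> q \<sigma>))"
| "eval_pattern X G \<rho> (PGroup P keys vs as) = (\<lambda>\<sigma>.
     group_solutions keys vs (map (\<lambda>f. f \<sigma>) (map (eval_aggregate X G \<rho>) as)) (eval_pattern X G \<rho> P \<sigma>))"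
| "eval_aggregate X G \<rho> (CountAll d) = (\<lambda>\<sigma> A. Some (int_lit (int (size (dedup d A)))))"
| "eval_aggregate X G \<rho> (Aggregate f d e) = (\<lambda>\<sigma> A.
     eval_set_function X f (dedup d {# eval_expr X G \<rho> e \<sigma> \<mu>. \<mu> \<in># A #}))"
| "eval_order X G \<rho> (Asc e) = (\<lambda>\<sigma> \<mu>. (False, eval_expr X G \<rho> e \<sigma> \<mu>))"
| "eval_order X G \<rho> (Desc e) = (\<lambda>\<sigma> \<mu>. (True, eval_expr X G \<rho> e \<sigma> \<mu>))"
| "eval_select X G \<rho> (Select d vs P os off lim) = (\<lambda>\<sigma>.
     (let keys = (\<lambda>\<mu>. map (\<lambda>f. f \<sigma> \<mu>) (map (eval_order X G \<rho>) os));
          ordered = sort_before (\<lambda>\<mu> \<nu>. before_lex X (map fst (keys \<mu>)) (map snd (keys \<mu>)) (map snd (keys \<nu>)))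
                      (to_list (eval_pattern X G \<rho> P \<sigma>));
          projected = map (\<lambda>\<mu>. \<mu> |` set vs) ordered
      in slice off lim (if d then rev (remdups (rev projected)) else projected)))"


section \<open>SPARQAL\<close>

datatype (svars_of_condition: 'n) condition =
    Times nat
  | Fixpoint 'n
  | Ask "'n pattern"

datatype 'n stmt =
    Assign 'n "'n select"
  | DoWhile "'n stmt list" "'n condition"
  | Return 'n

type_synonym 'n procedure = "'n stmt list"

subsection \<open>Procedures\<close>

fun assignments :: "'n stmt \<Rightarrow> ('n \<times> 'n select) set" where
  "assignments (Assign x Q) = {(x, Q)}"
| "assignments (DoWhile S c) = (\<Union>s\<in>set S. assignments s)"
| "assignments (Return x) = {}"

definition assigned :: "'n stmt list \<Rightarrow> 'n set" where
  "assigned S = fst ` (\<Union>s\<in>set S. assignments s)"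

definition schema :: "'n stmt list \<Rightarrow> 'n \<Rightarrow> var set" where
  "schema S x = \<Union>{set (projection Q) | Q. (x, Q) \<in> (\<Union>s\<in>set S. assignments s)}"

fun wf_condition :: "('n \<Rightarrow> var set) \<Rightarrow> 'n condition \<Rightarrow> bool" where
  "wf_condition sch (Times t) = (t > 0)"
| "wf_condition sch (Fixpoint x) = True"
| "wf_condition sch (Ask P) = wf_pattern sch P"

text \<open>\<open>A\<close> is the set of solution variables assigned in previous statements.  Return statements are
  not allowed here: they occur only at the very end of a procedure.  The condition of a loop comes
  after its body.\<close>

fun wf_stmt :: "('n \<Rightarrow> var set) \<Rightarrow> 'n set \<Rightarrow> 'n stmt \<Rightarrow> bool"
  and wf_stmts :: "('n \<Rightarrow> var set) \<Rightarrow> 'n set \<Rightarrow> 'n stmt list \<Rightarrow> bool" where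
  "wf_stmt sch A (Assign x Q) = (wf_select sch Q \<and> svars_of_select Q \<subseteq> A)"
| "wf_stmt sch A (DoWhile S c) =
     (wf_stmts sch A S \<and> wf_condition sch c \<and> svars_of_condition c \<subseteq> A \<union> assigned S)"
| "wf_stmt sch A (Return x) = False"
| "wf_stmts sch A [] = True"
| "wf_stmts sch A (s # S) = (wf_stmt sch A s \<and> wf_stmts sch (A \<union> assigned [s]) S)"

definition sparqal_procedure :: "'n procedure \<Rightarrow> bool" where
  "sparqal_procedure P \<longleftrightarrow>
     (\<exists>S x. P = S @ [Return x] \<and> wf_stmts (schema S) {} S \<and> x \<in> assigned S)"

subsection \<open>Semantics\<close>

fun satisfied :: "op_interp \<Rightarrow> rdf_graph \<Rightarrow> 'n condition \<Rightarrow> nat \<Rightarrow> ('n \<Rightarrow> mapping list) \<Rightarrow> ('n \<Rightarrow> mapping list) \<Rightarrow> bool" where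
  "satisfied X G (Times t) n \<rho> \<rho>' = (n \<ge> t)"
| "satisfied X G (Fixpoint x) n \<rho> \<rho>' = (set (\<rho>' x) = set (\<rho> x))"
| "satisfied X G (Ask P) n \<rho> \<rho>' = (eval_pattern X G \<rho>' P Map.empty \<noteq> {#})"

text \<open>Big-step semantics: no derivation exists for a diverging execution.  In \<open>loop\<close> the number is
  that of the iterations already completed.\<close>

inductive exec :: "op_interp \<Rightarrow> rdf_graph \<Rightarrow> 'n stmt \<Rightarrow> ('n \<Rightarrow> mapping list) \<Rightarrow> ('n \<Rightarrow> mapping list) \<Rightarrow> bool"
  and execs :: "op_interp \<Rightarrow> rdf_graph \<Rightarrow> 'n stmt list \<Rightarrow> ('n \<Rightarrow> mapping list) \<Rightarrow> ('n \<Rightarrow> mapping list) \<Rightarrow> bool"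
  and loop :: "op_interp \<Rightarrow> rdf_graph \<Rightarrow> 'n stmt list \<Rightarrow> 'n condition \<Rightarrow> nat \<Rightarrow> ('n \<Rightarrow> mapping list) \<Rightarrow> ('n \<Rightarrow> mapping list) \<Rightarrow> bool"
  for X :: op_interp and G :: rdf_graph where
  exec_let: "exec X G (Assign x Q) \<rho> (\<rho>(x := eval_select X G \<rho> Q Map.empty))"
| exec_do: "loop X G S c 0 \<rho> \<rho>' \<Longrightarrow> exec X G (DoWhile S c) \<rho> \<rho>'"
| execs_nil: "execs X G [] \<rho> \<rho>"
| execs_cons: "exec X G s \<rho> \<rho>\<^sub>1 \<Longrightarrow> execs X G S \<rho>\<^sub>1 \<rho>\<^sub>2 \<Longrightarrow> execs X G (s # S) \<rho> \<rho>\<^sub>2"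
| loop_stop: "execs X G S \<rho> \<rho>\<^sub>1 \<Longrightarrow> satisfied X G c (Suc n) \<rho> \<rho>\<^sub>1 \<Longrightarrow> loop X G S c n \<rho> \<rho>\<^sub>1"
| loop_again: "execs X G S \<rho> \<rho>\<^sub>1 \<Longrightarrow> \<not> satisfied X G c (Suc n) \<rho> \<rho>\<^sub>1 \<Longrightarrow>
    loop X G S c (Suc n) \<rho>\<^sub>1 \<rho>\<^sub>2 \<Longrightarrow> loop X G S c n \<rho> \<rho>\<^sub>2"

inductive produces :: "op_interp \<Rightarrow> rdf_graph \<Rightarrow> 'n procedure \<Rightarrow> mapping list \<Rightarrow> bool"
  for X :: op_interp and G :: rdf_graph where
  "execs X G S (\<lambda>_. []) \<rho> \<Longrightarrow> produces X G (S @ [Return x]) (\<rho> x)"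


section \<open>Turing machines\<close>

datatype move = MoveLeft | Stay | MoveRight

record ('q, 's) turing_machine =
  states :: "'q set"
  input_alphabet :: "'s set"
  tape_alphabet :: "'s set"
  blank :: 's
  start :: 'q
  accept :: 'q
  reject :: 'q
  delta :: "'q \<Rightarrow> 's \<Rightarrow> 'q \<times> 's \<times> move"

definition turing_machine :: "('q, 's, 'x) turing_machine_scheme \<Rightarrow> bool" where
  "turing_machine M \<longleftrightarrow>
     finite (states M) \<and> finite (tape_alphabet M) \<and>
     blank M \<in> tape_alphabet M \<and> input_alphabet M \<subseteq> tape_alphabet M - {blank M} \<and>
     start M \<in> states M \<and> accept M \<in> states M \<and> reject M \<in> states M \<and> accept M \<noteq> reject M \<and>
     (\<forall>q\<in>states M - {accept M, reject M}. \<forall>a\<in>tape_alphabet M.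
        delta M q a \<in> states M \<times> tape_alphabet M \<times> UNIV)"

text \<open>State, head position and contents of a tape that is infinite in both directions.\<close>

type_synonym ('q, 's) config = "'q \<times> int \<times> (int \<Rightarrow> 's)"

definition initial :: "('q, 's, 'x) turing_machine_scheme \<Rightarrow> 's list \<Rightarrow> ('q, 's) config" where
  "initial M w = (start M, 0, \<lambda>i. if 0 \<le> i \<and> i < int (length w) then w ! nat i else blank M)"

definition halted :: "('q, 's, 'x) turing_machine_scheme \<Rightarrow> ('q, 's) config \<Rightarrow> bool" where
  "halted M c \<longleftrightarrow> fst c \<in> {accept M, reject M}"

fun shift :: "move \<Rightarrow> int" where
  "shift MoveLeft = -1" | "shift Stay = 0" | "shift MoveRight = 1"

fun step :: "('q, 's, 'x) turing_machine_scheme \<Rightarrow> ('q, 's) config \<Rightarrow> ('q, 's) config" where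
  "step M (q, h, tape) = (if halted M (q, h, tape) then (q, h, tape)
     else case delta M q (tape h) of (q', a, m) \<Rightarrow> (q', h + shift m, tape(h := a)))"

definition run :: "('q, 's, 'x) turing_machine_scheme \<Rightarrow> 's list \<Rightarrow> nat \<Rightarrow> ('q, 's) config" where
  "run M w n = (step M ^^ n) (initial M w)"

definition accepts :: "('q, 's, 'x) turing_machine_scheme \<Rightarrow> 's list \<Rightarrow> bool" where
  "accepts M w \<longleftrightarrow> (\<exists>n. fst (run M w n) = accept M)"

text \<open>A transducer has in addition a write-only output tape, to which each step appends a
  finite (possibly empty) word.\<close>

record ('q, 's, 'o) transducer = "('q, 's) turing_machine" +
  emit :: "'q \<Rightarrow> 's \<Rightarrow> 'o list"

fun emitted :: "('q, 's, 'o) transducer \<Rightarrow> ('q, 's) config \<Rightarrow> 'o list" where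
  "emitted M (q, h, tape) = (if halted M (q, h, tape) then [] else emit M q (tape h))"

definition transduces :: "('q, 's, 'o) transducer \<Rightarrow> 's list \<Rightarrow> 'o list \<Rightarrow> bool" where
  "transduces M w out \<longleftrightarrow> (\<exists>n. fst (run M w n) = accept M \<and>
     out = concat (map (\<lambda>i. emitted M (run M w i)) [0..<n]))"


section \<open>Computable functions from words to RDF graphs\<close>

text \<open>A graph is output as an N-Triples document.\<close>

definition nt_char :: "char \<Rightarrow> string" where
  "nt_char c = (if c = CHR 0x22 \<or> c = CHR 0x5C then [CHR 0x5C, c]
     else if c = CHR 0x0A then [CHR 0x5C, CHR ''n'']
     else if c = CHR 0x0D then [CHR 0x5C, CHR ''r''] else [c])"

definition nt_quoted :: "string \<Rightarrow> string" where
  "nt_quoted s = [CHR 0x22] @ concat (map nt_char s) @ [CHR 0x22]"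

fun nt_term :: "rdf_term \<Rightarrow> string" where
  "nt_term (IRI i) = ''<'' @ i @ ''>''"
| "nt_term (BNode n) = ''_:b'' @ show_nat n"
| "nt_term (Literal s d) = nt_quoted s @ [CHR 0x5E, CHR 0x5E] @ ''<'' @ d @ ''>''"
| "nt_term (LangLiteral s l) = nt_quoted s @ ''@'' @ l"

definition nt_triple :: "triple \<Rightarrow> string" where
  "nt_triple = (\<lambda>(s, p, obj). nt_term s @ '' '' @ nt_term p @ '' '' @ nt_term obj @ '' .'' @ [CHR 0x0A])"

definition ntriples :: "triple list \<Rightarrow> string" where
  "ntriples ts = concat (map nt_triple ts)"

text \<open>The work alphabet of the transducer may be larger than \<open>\<Sigma>\<close>, whence the sum type.\<close>

definition computable_to_graphs :: "'s set \<Rightarrow> ('s list \<Rightarrow> rdf_graph) \<Rightarrow> bool" where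
  "computable_to_graphs \<Sigma> f \<longleftrightarrow>
     (\<exists>M :: (nat, 's + nat, char) transducer.
        turing_machine M \<and> input_alphabet M = Inl ` \<Sigma> \<and>
        (\<forall>w\<in>lists \<Sigma>. \<exists>ts. transduces M (map Inl w) (ntriples ts) \<and> set ts = f w))"

end

theory Submission
  imports Defs "HOL-Library.More_List"
begin

text \<open>A configuration is a single solution holding three string literals: the state, and the two
  halves of the tape as stacks of prefix-free unary codes with their tops at the head.  Reading a
  stack is \<open>STRSTARTS\<close>, popping is \<open>STRAFTER\<close> and pushing is \<open>CONCAT\<close>, so a step of the machine is
  a nested conditional expression.  The input graph is a single triple that holds the code of the word,
  and the loop runs until the accepting state is reached; a rejecting run makes it diverge.\<close>

section \<open>Evaluation of queries\<close>

lemma xsd_eq_iff [simp]: "xsd s = xsd t \<longleftrightarrow> s = t"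
  by (simp add: xsd_def)

lemma ebv_bool_lit [simp]: "ebv X (bool_lit b) = Some b"
  by (simp add: bool_lit_def)

lemma ebv_opt_bool_lit [simp]: "ebv_opt X (Some (bool_lit b)) = Some b"
  by (simp add: ebv_opt_def)

lemma holds_bool_lit [simp]: "holds X (Some (bool_lit b)) \<longleftrightarrow> b"
  by (simp add: holds_def)

lemma str_lit_eq_iff [simp]: "str_lit s = str_lit t \<longleftrightarrow> s = t"
  by (simp add: str_lit_def)

lemma str_compatible_str_lit [simp]: "str_compatible (str_lit s) (str_lit t)"
  by (simp add: str_compatible_def str_lit_def)

lemma lexical_str_lit [simp]: "lexical (str_lit s) = s"
  by (simp add: str_lit_def)

lemma same_kind_str_lit [simp]: "same_kind (str_lit s) t = str_lit t"
  by (simp add: str_lit_def)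

text \<open>All operators of the simulation are settled by \<open>op_core\<close> on string
  literals, so the interpretation \<open>X\<close> is never consulted and the procedure behaves
  alike under each \<open>X\<close>.\<close>

lemma apply_concat [simp]:
  "apply_op X OpConcat [str_lit s, str_lit t] = Some (str_lit (s @ t))"
  by (simp add: apply_op_def op_core_def concat_lits_def Let_def str_lit_def)

lemma apply_strstarts [simp]:
  "apply_op X OpStrStarts [str_lit s, str_lit t] = Some (bool_lit (\<exists>u. s = t @ u))"
  by (simp add: apply_op_def op_core_def)

text \<open>\<open>OpStrAfter\<close> cuts at the first occurrence, wherever it lies. For a prefix
  this occurrence is at 0, so the cut removes exactly \<open>p\<close> and acts as a pop.\<close>

lemma find_sub_prefix [simp]: "find_sub (p @ s) p = Some 0"
proof -
  have "(LEAST i. i \<le> length (p @ s) \<and> take (length p) (drop i (p @ s)) = p) = 0"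
    by (rule Least_equality) auto
  moreover have "\<exists>i. i \<le> length (p @ s) \<and> take (length p) (drop i (p @ s)) = p"
    by (rule exI[of _ 0]) simp
  ultimately show ?thesis
    unfolding find_sub_def Let_def by presburger
qed

lemma apply_strafter [simp]:
  "apply_op X OpStrAfter [str_lit (p @ s), str_lit p] = Some (str_lit s)"
  by (simp add: apply_op_def op_core_def)

lemma apply_sameterm [simp]: "apply_op X OpSameTerm [a, b] = Some (bool_lit (a = b))"
  by (simp add: apply_op_def op_core_def)

lemma and3_Some [simp]: "and3 (Some a) (Some b) = Some (a \<and> b)"
  by (auto simp: and3_def or3_def not3_def)

text \<open>The arbitrary choice of order in \<open>to_list\<close> is forced on one element.
  Keeping a configuration in a single solution thus makes all results determinate.\<close>

lemma to_list_singleton [simp]: "to_list {#x#} = [x]"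
  unfolding to_list_def by (rule some_equality) auto

lemma sort_before_singleton [simp]: "sort_before lt [x] = [x]"
  by (simp add: sort_before_def)

lemma slice_all [simp]: "slice 0 None xs = xs"
  by (simp add: slice_def)

lemma inline_data_empty [simp]: "inline_data Map.empty A = A"
proof -
  have "compatible Map.empty = (\<lambda>_. True)" by (simp add: compatible_def fun_eq_iff)
  then show ?thesis by (simp add: inline_data_def restrict_map_def)
qed

definition cases_expr :: "('x \<Rightarrow> 'n expr) \<Rightarrow> ('x \<Rightarrow> 'n expr) \<Rightarrow> 'x list \<Rightarrow> 'n expr" where
  "cases_expr c e xs = foldr (\<lambda>x. EIf (c x) (e x)) xs (ETerm (str_lit []))"

text \<open>An error in the condition of \<open>EIf\<close> is an error of the whole expression, so
  the tests are required to be defined. Since \<open>x\<close> is in the list, the default at the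
  end of \<open>cases_expr\<close> is never reached.\<close>

lemma eval_cases_expr:
  assumes "\<And>y. y \<in> set xs \<Longrightarrow> eval_expr X G \<rho> (c y) \<sigma> \<mu> = Some (bool_lit (y = x))" "x \<in> set xs"
  shows "eval_expr X G \<rho> (cases_expr c e xs) \<sigma> \<mu> = eval_expr X G \<rho> (e x) \<sigma> \<mu>"
  using assms by (induction xs) (auto simp: cases_expr_def)

lemma iri_ok_xsd_string [simp]: "iri_ok (xsd ''string'')"
  unfolding iri_ok_def xsd_def
  by (rule exI[of _ "CHR ''h''"], rule exI[of _ "''ttp''"],
      rule exI[of _ "''//www.w3.org/2001/XMLSchema#string''"])
    (simp add: lower_def upper_def digits_def less_eq_char_def less_char_def)

lemma wf_str_lit [simp]: "wf_term (str_lit s)" "\<not> is_bnode (str_lit s)"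
  unfolding str_lit_def by (simp, simp add: xsd_def rdf_lang_string_def)
    (simp add: str_lit_def)

lemma wf_cases_expr [simp]:
  "wf_expr sch (cases_expr c e xs)" if "\<And>x. wf_expr sch (c x)" "\<And>x. wf_expr sch (e x)"
  using that by (induction xs) (auto simp: cases_expr_def)

lemma svars_cases_expr [simp]:
  "svars_of_expr (cases_expr c e xs) = {}"
  if "\<And>x. svars_of_expr (c x) = {}" "\<And>x. svars_of_expr (e x) = {}"
  using that by (induction xs) (auto simp: cases_expr_def)


section \<open>Unary codes\<close>

definition unary :: "nat \<Rightarrow> string" where
  "unary n = replicate n CHR ''a'' @ ''b''"

text \<open>The closing \<open>b\<close> marks where the first code ends. Hence a prefix test
  identifies the top of a coded stack.\<close>

lemma unary_append_eq_iff: "unary m @ s = unary n @ t \<longleftrightarrow> m = n \<and> s = t"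
proof (induction m arbitrary: n)
  case 0
  then show ?case by (cases n) (auto simp: unary_def)
next
  case (Suc m)
  then show ?case by (cases n) (auto simp: unary_def)
qed

lemma unary_eq_iff [simp]: "unary m = unary n \<longleftrightarrow> m = n"
  using unary_append_eq_iff[of m "[]" n "[]"] by simp

text \<open>Codes consist of the letters a and b, which N-Triples does not escape, so a transducer
  can output them verbatim.\<close>

lemma nt_char_concat_unary:
  "concat (map nt_char (concat (map (\<lambda>a. unary (f a)) w))) = concat (map (\<lambda>a. unary (f a)) w)"
proof -
  have "concat (map nt_char (replicate n CHR ''a'')) = replicate n CHR ''a''" for n
    by (induction n) (auto simp: nt_char_def)
  then have "concat (map nt_char (unary n)) = unary n" for n
    by (simp add: unary_def) (simp add: nt_char_def)
  then show ?thesis by (induction w) auto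
qed


section \<open>Turing machines with two stacks\<close>

type_synonym ('q, 's) stacks = "'q \<times> 's list \<times> 's list"

text \<open>Only finite prefixes of the two halves of the tape are stored; everything else is blank.\<close>

definition represents ::
    "('q, 's, 'x) turing_machine_scheme \<Rightarrow> ('q, 's) stacks \<Rightarrow> ('q, 's) config \<Rightarrow> bool" where
  "represents M = (\<lambda>(q, ls, rs) (q', h, tape). q = q' \<and>
     (\<forall>n. tape (h + int n) = nth_default (blank M) rs n) \<and>
     (\<forall>n. tape (h - 1 - int n) = nth_default (blank M) ls n))"

text \<open>\<open>turing_machine\<close> does not constrain \<open>delta\<close> in halting states.
  Writing back the scanned symbol and staying reproduces the idle branch of \<open>step\<close>, so
  one finite table covers all states.\<close>

definition delta' :: "('q, 's, 'x) turing_machine_scheme \<Rightarrow> 'q \<Rightarrow> 's \<Rightarrow> 'q \<times> 's \<times> move" where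
  "delta' M q a = (if q \<in> {accept M, reject M} then (q, a, Stay) else delta M q a)"

text \<open>The scanned cell is the top of the right stack. Both stacks arrive already popped:
  \<open>b\<close> came off the left one, and \<open>a\<close> is the symbol just written. Each move
  only decides where these two are pushed.\<close>

fun move_stacks :: "move \<Rightarrow> 's \<Rightarrow> 's \<Rightarrow> 's list \<Rightarrow> 's list \<Rightarrow> 's list \<times> 's list" where
  "move_stacks MoveLeft b a ls rs = (ls, b # a # rs)"
| "move_stacks Stay b a ls rs = (b # ls, a # rs)"
| "move_stacks MoveRight b a ls rs = (a # b # ls, rs)"

definition stack_top :: "('q, 's, 'x) turing_machine_scheme \<Rightarrow> 's list \<Rightarrow> 's" where
  "stack_top M xs = hd (xs @ [blank M])"

text \<open>The padding blank stays at the bottom when a nonempty stack is popped, just as in the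
  string expressions of the query. \<open>represents\<close> cannot see it, because
  \<open>nth_default\<close> yields a blank there anyway.\<close>

definition stack_pop :: "('q, 's, 'x) turing_machine_scheme \<Rightarrow> 's list \<Rightarrow> 's list" where
  "stack_pop M xs = tl (xs @ [blank M])"

definition stack_step ::
    "('q, 's, 'x) turing_machine_scheme \<Rightarrow> ('q, 's) stacks \<Rightarrow> ('q, 's) stacks" where
  "stack_step M = (\<lambda>(q, ls, rs). case delta' M q (stack_top M rs) of
     (q', a, m) \<Rightarrow> (q', move_stacks m (stack_top M ls) a (stack_pop M ls) (stack_pop M rs)))"

lemma stack_top_pop: "stack_top M xs # stack_pop M xs = xs @ [blank M]"
  by (simp add: stack_top_def stack_pop_def)

lemma nth_default_stack_top: "stack_top M xs = nth_default (blank M) xs 0"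
  by (cases xs) (auto simp: stack_top_def)

lemma nth_default_stack_pop:
  "nth_default (blank M) (stack_pop M xs) n = nth_default (blank M) xs (Suc n)"
  by (cases xs) (auto simp: stack_pop_def nth_default_def nth_append)

lemma step_delta':
  "step M (q, h, tape) = (case delta' M q (tape h) of (q', a, m) \<Rightarrow> (q', h + shift m, tape(h := a)))"
  by (auto simp: delta'_def halted_def)

lemma represents_step:
  assumes "represents M c d"
  shows "represents M (stack_step M c) (step M d)"
proof -
  obtain q ls rs where c: "c = (q, ls, rs)" by (cases c)
  obtain h tape where d: "d = (q, h, tape)"
    using assms by (cases d) (auto simp: c represents_def)
  have r: "tape (h + int n) = nth_default (blank M) rs n" for n
    using assms by (simp add: c d represents_def)
  have l: "tape (h - 1 - int n) = nth_default (blank M) ls n" for n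
    using assms by (simp add: c d represents_def)
  obtain q' a m where dl: "delta' M q (tape h) = (q', a, m)" by (cases "delta' M q (tape h)")
  have top: "stack_top M rs = tape h" "stack_top M ls = tape (h - 1)"
    using r[of 0] l[of 0] by (simp_all add: nth_default_stack_top)
  have pops: "nth_default (blank M) (stack_pop M rs) n = tape (h + 1 + int n)"
    "nth_default (blank M) (stack_pop M ls) n = tape (h - 2 - int n)" for n
    using r[of "Suc n"] l[of "Suc n"] by (simp_all add: nth_default_stack_pop algebra_simps)
  show ?thesis
  proof (cases m)
    case MoveLeft
    have "(tape(h := a)) (h - 1 + int n) =
        nth_default (blank M) (tape (h - 1) # a # stack_pop M rs) n" for n
    \<comment> \<open>Indices 0 and 1 are the two pushed symbols; from index 2 on, the cells come
      from the popped right stack.\<close>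
    proof (cases n)
      case (Suc k)
      then show ?thesis by (cases k) (auto simp: pops algebra_simps)
    qed simp
    moreover have "(tape(h := a)) (h - 1 - 1 - int n) = nth_default (blank M) (stack_pop M ls) n" for n
      by (simp add: pops algebra_simps)
    ultimately show ?thesis
      by (simp add: represents_def stack_step_def c d step_delta' dl top MoveLeft del: step.simps)
  next
    case Stay
    have "(tape(h := a)) (h + int n) = nth_default (blank M) (a # stack_pop M rs) n" for n
      by (cases n) (auto simp: pops algebra_simps)
    moreover have "(tape(h := a)) (h - 1 - int n) =
        nth_default (blank M) (tape (h - 1) # stack_pop M ls) n" for n
      by (cases n) (auto simp: pops algebra_simps)
    ultimately show ?thesis
      by (simp add: represents_def stack_step_def c d step_delta' dl top Stay del: step.simps)
  next
    case MoveRight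
    have "(tape(h := a)) (h + 1 + int n) = nth_default (blank M) (stack_pop M rs) n" for n
      by (simp add: pops algebra_simps)
    moreover have "(tape(h := a)) (h + 1 - 1 - int n) =
        nth_default (blank M) (a # tape (h - 1) # stack_pop M ls) n" for n
    proof (cases n)
      case (Suc k)
      then show ?thesis by (cases k) (auto simp: pops algebra_simps)
    qed simp
    ultimately show ?thesis
      by (simp add: represents_def stack_step_def c d step_delta' dl top MoveRight del: step.simps)
  qed
qed

lemma represents_fst: "represents M c d \<Longrightarrow> fst c = fst d"
  by (auto simp: represents_def)

lemma represents_initial: "represents M (start M, [], w) (initial M w)"
  by (auto simp: represents_def initial_def nth_default_def)

lemma accepts_iff_stacks:
  "accepts M w \<longleftrightarrow> (\<exists>n. fst ((stack_step M ^^ n) (start M, [], w)) = accept M)"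
proof -
  have "represents M ((stack_step M ^^ n) (start M, [], w)) (run M w n)" for n
    by (induction n) (auto simp: run_def represents_initial represents_step)
  then have "fst ((stack_step M ^^ n) (start M, [], w)) = fst (run M w n)" for n
    using represents_fst by blast
  then show ?thesis by (simp add: accepts_def)
qed

text \<open>Invariant of the simulation: the numberings of states and symbols are injective only on
  these finite sets, and the case distinction of the query lists only their elements.\<close>

definition stacks_ok :: "('q, 's, 'x) turing_machine_scheme \<Rightarrow> ('q, 's) stacks \<Rightarrow> bool" where
  "stacks_ok M = (\<lambda>(q, ls, rs). q \<in> states M \<and> set ls \<subseteq> tape_alphabet M \<and> set rs \<subseteq> tape_alphabet M)"

lemma stack_top_pop_in:
  assumes "turing_machine M" "set xs \<subseteq> tape_alphabet M"
  shows "stack_top M xs \<in> tape_alphabet M" "set (stack_pop M xs) \<subseteq> tape_alphabet M"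
proof -
  have "set (stack_top M xs # stack_pop M xs) \<subseteq> tape_alphabet M"
    unfolding stack_top_pop using assms by (auto simp: turing_machine_def)
  then show "stack_top M xs \<in> tape_alphabet M" "set (stack_pop M xs) \<subseteq> tape_alphabet M" by auto
qed

lemma stacks_ok_step:
  assumes M: "turing_machine M" and c: "stacks_ok M c"
  shows "stacks_ok M (stack_step M c)"
proof -
  obtain q ls rs where c_eq: "c = (q, ls, rs)" by (cases c)
  have ok: "q \<in> states M" "set ls \<subseteq> tape_alphabet M" "set rs \<subseteq> tape_alphabet M"
    using c by (auto simp: c_eq stacks_ok_def)
  note l = stack_top_pop_in[OF M ok(2)] and r = stack_top_pop_in[OF M ok(3)]
  obtain q' a m where d: "delta' M q (stack_top M rs) = (q', a, m)"
    by (cases "delta' M q (stack_top M rs)")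
  have "q' \<in> states M \<and> a \<in> tape_alphabet M"
  proof (cases "q \<in> {accept M, reject M}")
    case True
    then show ?thesis using d ok(1) r(1) by (auto simp: delta'_def)
  next
    case False
    then have "delta M q (stack_top M rs) \<in> states M \<times> tape_alphabet M \<times> UNIV"
      using M ok(1) r(1) by (auto simp: turing_machine_def)
    then show ?thesis using d False by (auto simp: delta'_def)
  qed
  then show ?thesis
    using l r by (cases m) (auto simp: c_eq stack_step_def d stacks_ok_def)
qed


section \<open>The simulating procedure\<close>

locale encoded_machine =
  fixes M :: "('q, 's) turing_machine"
    and nq :: "'q \<Rightarrow> nat" and ns :: "'s \<Rightarrow> nat" and qs :: "'q list" and as :: "'s list"
  assumes M: "turing_machine M"
    and inj_nq: "inj_on nq (states M)" and inj_ns: "inj_on ns (tape_alphabet M)"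
    and set_qs: "set qs = states M" and set_as: "set as = tape_alphabet M"
begin

definition code :: "'s list \<Rightarrow> string" where
  "code w = concat (map (\<lambda>a. unary (ns a)) w)"

lemma code_simps [simp]: "code [] = []" "code (a # w) = unary (ns a) @ code w"
  by (simp_all add: code_def)

lemma code_append [simp]: "code (v @ w) = code v @ code w"
  by (simp add: code_def)

definition solution :: "('q, 's) stacks \<Rightarrow> mapping" where
  "solution = (\<lambda>(q, ls, rs). [''q'' \<mapsto> str_lit (unary (nq q)),
     ''l'' \<mapsto> str_lit (code ls), ''r'' \<mapsto> str_lit (code rs)])"

abbreviation "subj \<equiv> IRI ''x:s''"
abbreviation "pred \<equiv> IRI ''x:p''"

definition graph :: "'s list \<Rightarrow> rdf_graph" where
  "graph w = {(subj, pred, str_lit (code w))}"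

definition init_query :: "string select" where
  "init_query = Select False [''q'', ''l'', ''r'']
     (PBind (PBind (PBgp [(T subj, T pred, V ''r'')])
        ''q'' (ETerm (str_lit (unary (nq (start M))))))
        ''l'' (ETerm (str_lit []))) [] 0 None"

abbreviation "cat e f \<equiv> EApply OpConcat [e, f]"
abbreviation "code_term w \<equiv> ETerm (str_lit (code w))"

text \<open>The stacks are padded with a blank before they are read, so that they are not empty.\<close>

definition left_expr :: "string expr" where
  "left_expr = cat (EVar ''l'') (code_term [blank M])"

definition right_expr :: "string expr" where
  "right_expr = cat (EVar ''r'') (code_term [blank M])"

text \<open>Besides the state and the scanned symbol \<open>a\<close>, the test fixes the left
  neighbour \<open>b\<close>: popping by \<open>OpStrAfter\<close> needs its code as a constant, and
  a left move pushes it onto the right stack.\<close>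

definition test_expr :: "'q \<times> 's \<times> 's \<Rightarrow> string expr" where
  "test_expr = (\<lambda>(q, b, a). EAnd (EApply OpSameTerm [EVar ''q'', ETerm (str_lit (unary (nq q)))])
     (EAnd (EApply OpStrStarts [left_expr, code_term [b]])
        (EApply OpStrStarts [right_expr, code_term [a]])))"

definition pop_left :: "'s \<Rightarrow> string expr" where
  "pop_left b = EApply OpStrAfter [left_expr, code_term [b]]"

definition pop_right :: "'s \<Rightarrow> string expr" where
  "pop_right a = EApply OpStrAfter [right_expr, code_term [a]]"

definition new_state :: "'q \<times> 's \<times> 's \<Rightarrow> string expr" where
  "new_state = (\<lambda>(q, b, a). ETerm (str_lit (unary (nq (fst (delta' M q a))))))"

text \<open>On empty stacks \<open>move_stacks\<close> returns exactly the words to be pushed. They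
  depend only on the triple, so they enter the query as literals.\<close>

definition new_left :: "'q \<times> 's \<times> 's \<Rightarrow> string expr" where
  "new_left = (\<lambda>(q, b, a). case delta' M q a of (q', a', m) \<Rightarrow>
     cat (code_term (fst (move_stacks m b a' [] []))) (pop_left b))"

definition new_right :: "'q \<times> 's \<times> 's \<Rightarrow> string expr" where
  "new_right = (\<lambda>(q, b, a). case delta' M q a of (q', a', m) \<Rightarrow>
     cat (code_term (snd (move_stacks m b a' [] []))) (pop_right a))"

definition triples :: "('q \<times> 's \<times> 's) list" where
  "triples = List.product qs (List.product as as)"

text \<open>Since \<open>BIND\<close> must introduce fresh variables, the new values are renamed back outside a
  subquery that hides the old ones.\<close>

definition step_query :: "string select" where
  "step_query = Select False [''q'', ''l'', ''r'']
     (PBind (PBind (PBind (PSubSelect (Select False [''q2'', ''l2'', ''r2'']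
        (PBind (PBind (PBind (PQValues ''cfg'')
           ''q2'' (cases_expr test_expr new_state triples))
           ''l2'' (cases_expr test_expr new_left triples))
           ''r2'' (cases_expr test_expr new_right triples)) [] 0 None))
        ''q'' (EVar ''q2'')) ''l'' (EVar ''l2'')) ''r'' (EVar ''r2'')) [] 0 None"

definition accept_cond :: "string condition" where
  "accept_cond = Ask (PFilter (EApply OpSameTerm [EVar ''q'', ETerm (str_lit (unary (nq (accept M))))])
     (PQValues ''cfg''))"

definition simulator :: "string procedure" where
  "simulator = [Assign ''cfg'' init_query, DoWhile [Assign ''cfg'' step_query] accept_cond,
     Return ''cfg'']"

section \<open>Well-formedness of the simulating procedure\<close>

lemma wf_exprs [simp]: "wf_expr sch (test_expr x)" "wf_expr sch (new_state x)"
  "wf_expr sch (new_left x)" "wf_expr sch (new_right x)"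
  by (auto simp: test_expr_def new_state_def new_left_def new_right_def left_expr_def
      right_expr_def pop_left_def pop_right_def split: prod.split)

lemma svars_exprs [simp]: "svars_of_expr (test_expr x) = {}" "svars_of_expr (new_state x) = {}"
  "svars_of_expr (new_left x) = {}" "svars_of_expr (new_right x) = {}"
  by (auto simp: test_expr_def new_state_def new_left_def new_right_def left_expr_def
      right_expr_def pop_left_def pop_right_def split: prod.split)

lemma wf_subj_pred [simp]: "iri_ok ''x:s''" "iri_ok ''x:p''"
  unfolding iri_ok_def
  by (rule exI[of _ "CHR ''x''"], rule exI[of _ "[]"], rule exI[of _ "''s''"],
      simp add: lower_def upper_def less_eq_char_def less_char_def)
    (rule exI[of _ "CHR ''x''"], rule exI[of _ "[]"], rule exI[of _ "''p''"],
      simp add: lower_def upper_def less_eq_char_def less_char_def)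

text \<open>The schema matters for \<open>step_query\<close> because its inner \<open>PBind\<close>s
  must introduce variables that no value of the solution variable can bind.\<close>

lemma wf_queries:
  "wf_select sch init_query" "wf_condition sch accept_cond"
  "sch ''cfg'' = {''q'', ''l'', ''r''} \<Longrightarrow> wf_select sch step_query"
  by (simp_all add: init_query_def step_query_def accept_cond_def)

lemma svars_queries:
  "svars_of_select init_query = {}" "svars_of_select step_query = {''cfg''}"
  "svars_of_condition accept_cond = {''cfg''}"
  by (simp_all add: init_query_def step_query_def accept_cond_def)

lemma projection_queries:
  "projection init_query = [''q'', ''l'', ''r'']" "projection step_query = [''q'', ''l'', ''r'']"
  by (simp_all add: init_query_def step_query_def)

lemma sparqal_procedure_simulator: "sparqal_procedure simulator"
proof -
  let ?S = "[Assign ''cfg'' init_query, DoWhile [Assign ''cfg'' step_query] accept_cond]"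
  have "schema ?S ''cfg'' = set (projection init_query) \<union> set (projection step_query)"
    by (auto simp: schema_def)
  then have "schema ?S ''cfg'' = {''q'', ''l'', ''r''}"
    by (simp only: projection_queries Un_absorb list.set)
  then have "wf_stmts (schema ?S) {} ?S"
    by (simp add: wf_queries svars_queries assigned_def)
  then show ?thesis
    unfolding sparqal_procedure_def simulator_def
    by (intro exI[of _ ?S] exI[of _ "''cfg''"]) (simp add: assigned_def)
qed

lemma graph_is_rdf_graph: "is_rdf_graph (graph w)"
  by (auto simp: graph_def is_rdf_graph_def is_literal_def)

section \<open>Results of the two queries\<close>

lemma eval_init_query:
  "eval_select X (graph w) \<rho> init_query Map.empty = [solution (start M, [], w)]"
proof -
  have "bgp_solutions (graph w) [(T subj, T pred, V ''r'')] = {[''r'' \<mapsto> str_lit (code w)]}"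
    by (auto simp: bgp_solutions_def graph_def dom_eq_singleton_conv)
  then show ?thesis
    by (simp add: init_query_def solution_def fun_eq_iff)
qed

text \<open>Exactly one triple passes its test, namely the current state with the two stack tops.
  Its branches pop both padded stacks and push the words prescribed by the move.\<close>

lemma eval_step_query:
  assumes \<rho>: "\<rho> ''cfg'' = [solution c]" and c: "stacks_ok M c"
  shows "eval_select X G \<rho> step_query Map.empty = [solution (stack_step M c)]"
proof -
  obtain q ls rs where c_eq: "c = (q, ls, rs)" by (cases c)
  have ok: "q \<in> states M" "set ls \<subseteq> tape_alphabet M" "set rs \<subseteq> tape_alphabet M"
    using c by (auto simp: c_eq stacks_ok_def)
  note l = stack_top_pop_in[OF M ok(2)] and r = stack_top_pop_in[OF M ok(3)]
  let ?x = "(q, stack_top M ls, stack_top M rs)"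
  have x: "?x \<in> set triples"
    using ok(1) l(1) r(1) by (simp add: triples_def set_qs set_as)
  obtain q' a' m where d: "delta' M q (stack_top M rs) = (q', a', m)"
    by (cases "delta' M q (stack_top M rs)")
  have step: "stack_step M c = (q', move_stacks m (stack_top M ls) a' (stack_pop M ls) (stack_pop M rs))"
    by (simp add: stack_step_def c_eq d)
  \<comment> \<open>The nested \<open>PBind\<close>s evaluate later expressions on mappings already
    extended by \<open>q2\<close> and \<open>l2\<close>; \<open>agree\<close> records only the
    variables that are read.\<close>
  define agree where "agree \<mu> \<longleftrightarrow> (\<forall>v\<in>{''q'', ''l'', ''r''}. \<mu> v = solution c v)" for \<mu> :: mapping
  \<comment> \<open>Padding on strings matches padding on stacks, which exposes the code of the top
    as a prefix.\<close>
  have pad: "code ys @ unary (ns (blank M)) = unary (ns (stack_top M ys)) @ code (stack_pop M ys)" for ys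
    using arg_cong[OF stack_top_pop[of M ys], of code] by simp
  have left: "eval_expr X G \<rho> left_expr Map.empty \<mu> =
      Some (str_lit (unary (ns (stack_top M ls)) @ code (stack_pop M ls)))"
    and right: "eval_expr X G \<rho> right_expr Map.empty \<mu> =
      Some (str_lit (unary (ns (stack_top M rs)) @ code (stack_pop M rs)))"
    if "agree \<mu>" for \<mu>
    using that by (simp_all add: agree_def left_expr_def right_expr_def solution_def c_eq
        apply_strict_def pad)
  have "eval_expr X G \<rho> (test_expr y) Map.empty \<mu> = Some (bool_lit (y = ?x))"
    if "agree \<mu>" "y \<in> set triples" for \<mu> y
  proof -
    obtain p b a where y: "y = (p, b, a)" by (cases y)
    have "p \<in> states M" "b \<in> tape_alphabet M" "a \<in> tape_alphabet M"
      using that(2) by (auto simp: y triples_def set_qs set_as)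
    then have "nq q = nq p \<longleftrightarrow> p = q" "ns (stack_top M ls) = ns b \<longleftrightarrow> b = stack_top M ls"
      "ns (stack_top M rs) = ns a \<longleftrightarrow> a = stack_top M rs"
      using ok l r by (auto simp: inj_on_eq_iff[OF inj_nq] inj_on_eq_iff[OF inj_ns])
    then show ?thesis
      using that(1)
      by (simp add: test_expr_def y left[OF that(1)] right[OF that(1)] apply_strict_def
          unary_append_eq_iff)
        (simp add: agree_def solution_def c_eq)
  qed
  note cases = eval_cases_expr[OF this x]
  have q': "eval_expr X G \<rho> (cases_expr test_expr new_state triples) Map.empty \<mu> =
      Some (str_lit (unary (nq q')))" if "agree \<mu>" for \<mu>
    using that by (simp add: cases new_state_def d)
  have l': "eval_expr X G \<rho> (cases_expr test_expr new_left triples) Map.empty \<mu> =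
      Some (str_lit (code (fst (snd (stack_step M c)))))" if "agree \<mu>" for \<mu>
    using that
    by (cases m) (simp_all add: cases new_left_def pop_left_def d step left apply_strict_def)
  have r': "eval_expr X G \<rho> (cases_expr test_expr new_right triples) Map.empty \<mu> =
      Some (str_lit (code (snd (snd (stack_step M c)))))" if "agree \<mu>" for \<mu>
    using that
    by (cases m) (simp_all add: cases new_right_def pop_right_def d step right apply_strict_def)
  show ?thesis
    by (simp add: step_query_def \<rho> q' l' r' agree_def step)
      (simp add: solution_def fun_eq_iff split: prod.split)
qed

section \<open>Execution of the loop\<close>

lemma satisfied_accept_cond:
  assumes "\<rho>' ''cfg'' = [solution c]" "stacks_ok M c"
  shows "satisfied X G accept_cond n \<rho> \<rho>' \<longleftrightarrow> fst c = accept M"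
proof -
  have "fst c \<in> states M" "accept M \<in> states M"
    using assms(2) M by (auto simp: stacks_ok_def turing_machine_def)
  then show ?thesis
    using assms(1)
    by (auto simp: accept_cond_def solution_def apply_strict_def inj_on_eq_iff[OF inj_nq]
        split: prod.splits)
qed

lemma exec_step_query:
  assumes "\<rho> ''cfg'' = [solution c]" "stacks_ok M c"
  shows "execs X G [Assign ''cfg'' step_query] \<rho> \<rho>' \<longleftrightarrow>
    \<rho>' = \<rho>(''cfg'' := [solution (stack_step M c)])"
proof -
  have "execs X G [Assign ''cfg'' step_query] \<rho> \<rho>' \<longleftrightarrow>
      \<rho>' = \<rho>(''cfg'' := eval_select X G \<rho> step_query Map.empty)"
    by (auto elim: execs.cases exec.cases intro: exec_let execs_cons execs_nil)
  then show ?thesis by (simp add: eval_step_query[of \<rho> c, OF assms])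
qed

lemma loop_reaches_accept:
  assumes "loop X G [Assign ''cfg'' step_query] accept_cond k \<rho> \<rho>'"
    and "\<rho> ''cfg'' = [solution c]" "stacks_ok M c"
  shows "\<exists>n. fst ((stack_step M ^^ n) c) = accept M"
proof -
  \<comment> \<open>Rule induction wants variables as arguments, so body and condition are
    generalised and pinned down by equations. Of the three mutual predicates only
    \<open>loop\<close> carries a claim.\<close>
  have "S = [Assign ''cfg'' step_query] \<Longrightarrow> cond = accept_cond \<Longrightarrow> \<rho> ''cfg'' = [solution c] \<Longrightarrow>
      stacks_ok M c \<Longrightarrow> \<exists>n. fst ((stack_step M ^^ n) c) = accept M"
    if "loop X G S cond k \<rho> \<rho>'" for S cond k \<rho> \<rho>' c
    using that
  proof (induction arbitrary: c rule: exec_execs_loop.inducts(3)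
      [where ?P1.0 = "\<lambda>_ _ _. True" and ?P2.0 = "\<lambda>_ _ _. True"])
    case (loop_stop S \<rho> \<rho>1 cond k)
    then have \<rho>1: "\<rho>1 = \<rho>(''cfg'' := [solution (stack_step M c)])"
      using exec_step_query by blast
    have "fst (stack_step M c) = accept M"
      using satisfied_accept_cond[of \<rho>1 "stack_step M c"] loop_stop stacks_ok_step[OF M]
      by (simp add: \<rho>1)
    then show ?case by (intro exI[of _ 1]) simp
  next
    case (loop_again S \<rho> \<rho>1 cond k \<rho>2)
    then have \<rho>1: "\<rho>1 = \<rho>(''cfg'' := [solution (stack_step M c)])"
      using exec_step_query by blast
    have "\<exists>n. fst ((stack_step M ^^ n) (stack_step M c)) = accept M"
      using loop_again by (simp add: \<rho>1 stacks_ok_step[OF M])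
    then show ?case
      by (metis funpow_Suc_right comp_apply)
  qed auto
  then show ?thesis using assms by blast
qed

text \<open>The body runs before the first test, hence \<open>Suc n\<close>. The final configuration
  is left open, as only the presence of a solution will matter.\<close>

lemma loop_terminates:
  assumes "fst ((stack_step M ^^ Suc n) c) = accept M"
    and "\<rho> ''cfg'' = [solution c]" "stacks_ok M c"
  shows "\<exists>\<rho>' d. loop X G [Assign ''cfg'' step_query] accept_cond k \<rho> \<rho>' \<and> \<rho>' ''cfg'' = [solution d]"
  using assms
proof (induction n arbitrary: c k \<rho>)
  case 0
  let ?\<rho>' = "\<rho>(''cfg'' := [solution (stack_step M c)])"
  have "execs X G [Assign ''cfg'' step_query] \<rho> ?\<rho>'"
    using 0 by (simp add: exec_step_query)
  moreover have "satisfied X G accept_cond (Suc k) \<rho> ?\<rho>'"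
    using 0 by (subst satisfied_accept_cond[of _ "stack_step M c"]) (auto simp: stacks_ok_step[OF M])
  ultimately show ?case
    by (metis fun_upd_same loop_stop)
next
  case (Suc n)
  let ?\<rho>' = "\<rho>(''cfg'' := [solution (stack_step M c)])"
  have exec: "execs X G [Assign ''cfg'' step_query] \<rho> ?\<rho>'"
    using Suc.prems by (simp add: exec_step_query)
  show ?case
  \<comment> \<open>Acceptance may already occur before the given number of steps, and then the loop
    stops early.\<close>
  proof (cases "satisfied X G accept_cond (Suc k) \<rho> ?\<rho>'")
    case True
    with exec show ?thesis
      by (metis fun_upd_same loop_stop)
  next
    case False
    have acc: "fst ((stack_step M ^^ Suc n) (stack_step M c)) = accept M"
      using Suc.prems(1) by (metis funpow_Suc_right comp_apply)
    obtain \<rho>' d where "loop X G [Assign ''cfg'' step_query] accept_cond (Suc k) ?\<rho>' \<rho>'"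
      "\<rho>' ''cfg'' = [solution d]"
      using Suc.IH[OF acc, of ?\<rho>' "Suc k"] stacks_ok_step[OF M Suc.prems(3)] by (metis fun_upd_same)
    then show ?thesis using loop_again[OF exec False] by blast
  qed
qed

text \<open>This absorbs the forced first iteration when the start state is itself
  accepting.\<close>

lemma stack_step_accept: "fst c = accept M \<Longrightarrow> fst (stack_step M c) = accept M"
  by (auto simp: stack_step_def delta'_def split: prod.splits)

lemma simulator_correct:
  assumes w: "w \<in> lists (input_alphabet M)"
  shows "accepts M w \<longleftrightarrow> (\<exists>r. produces X (graph w) simulator r \<and> r \<noteq> [])"
proof
  let ?c = "(start M, [], w)" and ?\<rho> = "(\<lambda>_. [])(''cfg'' := [solution (start M, [], w)])"
  let ?S = "[Assign ''cfg'' init_query, DoWhile [Assign ''cfg'' step_query] accept_cond]"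
  have ok: "stacks_ok M ?c"
    using w M by (auto simp: stacks_ok_def turing_machine_def)
  have init: "exec X (graph w) (Assign ''cfg'' init_query) (\<lambda>_. []) ?\<rho>"
    using exec_let[of X "graph w" "''cfg''" init_query "\<lambda>_. []"] by (simp add: eval_init_query)
  have init_unique: "\<rho> = ?\<rho>" if "exec X (graph w) (Assign ''cfg'' init_query) (\<lambda>_. []) \<rho>" for \<rho>
    using that by (auto elim: exec.cases simp: eval_init_query)
  {
    assume "accepts M w"
    then obtain n where "fst ((stack_step M ^^ n) ?c) = accept M"
      by (auto simp: accepts_iff_stacks)
    then have "fst ((stack_step M ^^ Suc n) ?c) = accept M"
      by (simp add: stack_step_accept)
    then obtain \<rho>' d where "loop X (graph w) [Assign ''cfg'' step_query] accept_cond 0 ?\<rho> \<rho>'"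
      and d: "\<rho>' ''cfg'' = [solution d]"
      using loop_terminates[of n ?c ?\<rho>, OF _ _ ok] by (metis fun_upd_same)
    then have "execs X (graph w) ?S (\<lambda>_. []) \<rho>'"
      by (intro execs_cons[OF init] execs_cons[OF exec_do execs_nil])
    then have "produces X (graph w) (?S @ [Return ''cfg'']) (\<rho>' ''cfg'')"
      by (rule produces.intros)
    then show "\<exists>r. produces X (graph w) simulator r \<and> r \<noteq> []"
      using d by (auto simp: simulator_def)
  next
    \<comment> \<open>A result presupposes that the loop has terminated, and its last test saw the
      accepting state.\<close>
    assume "\<exists>r. produces X (graph w) simulator r \<and> r \<noteq> []"
    then obtain \<rho>' where "execs X (graph w) ?S (\<lambda>_. []) \<rho>'"
      by (auto simp: simulator_def elim!: produces.cases)
    then obtain \<rho>1 \<rho>2 where "exec X (graph w) (Assign ''cfg'' init_query) (\<lambda>_. []) \<rho>1"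
      "exec X (graph w) (DoWhile [Assign ''cfg'' step_query] accept_cond) \<rho>1 \<rho>2"
      by (auto elim!: execs.cases)
    then have "loop X (graph w) [Assign ''cfg'' step_query] accept_cond 0 ?\<rho> \<rho>2"
      using init_unique by (auto elim: exec.cases)
    then show "accepts M w"
      using loop_reaches_accept[of X "graph w" 0 ?\<rho> \<rho>2 ?c] ok by (simp add: accepts_iff_stacks)
  }
qed


subsection \<open>Computability of the input graph\<close>

text \<open>State 0 outputs the opening of the triple without moving, so that this happens once even
  for the empty word. State 1 translates letters up to the first blank, where the closing is
  output.\<close>

definition encoder :: "(nat, 's + nat, char) transducer" where
  "encoder = \<lparr>states = {0, 1, 2, 3}, input_alphabet = Inl ` input_alphabet M,
     tape_alphabet = insert (Inr 0) (Inl ` input_alphabet M), blank = Inr 0,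
     start = 0, accept = 2, reject = 3,
     delta = (\<lambda>q x. if q = 0 then (1, x, Stay) else if x = Inr 0 then (2, x, Stay) else (1, x, MoveRight)),
     emit = (\<lambda>q x. if q = 0 then nt_term subj @ '' '' @ nt_term pred @ '' '' @ [CHR 0x22]
       else case x of Inl a \<Rightarrow> unary (ns a)
       | Inr _ \<Rightarrow> [CHR 0x22, CHR 0x5E, CHR 0x5E] @ ''<'' @ xsd ''string'' @ ''>'' @ '' .'' @ [CHR 0x0A])\<rparr>"

lemma encoder_simps [simp]:
  "states encoder = {0, 1, 2, 3}" "input_alphabet encoder = Inl ` input_alphabet M"
  "tape_alphabet encoder = insert (Inr 0) (Inl ` input_alphabet M)" "blank encoder = Inr 0"
  "start encoder = 0" "accept encoder = 2" "reject encoder = 3"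
  "delta encoder q x =
     (if q = 0 then (1, x, Stay) else if x = Inr 0 then (2, x, Stay) else (1, x, MoveRight))"
  "emit encoder 0 x = nt_term subj @ '' '' @ nt_term pred @ '' '' @ [CHR 0x22]"
  "q \<noteq> 0 \<Longrightarrow> emit encoder q (Inl a) = unary (ns a)"
  "q \<noteq> 0 \<Longrightarrow> emit encoder q (Inr n) =
     [CHR 0x22, CHR 0x5E, CHR 0x5E] @ ''<'' @ xsd ''string'' @ ''>'' @ '' .'' @ [CHR 0x0A]"
  by (auto simp: encoder_def)

lemma turing_machine_encoder: "turing_machine encoder"
proof -
  have "finite (input_alphabet M)"
    using M finite_subset by (fastforce simp: turing_machine_def)
  then show ?thesis by (auto simp: turing_machine_def)
qed

text \<open>The first step does not move, so after \<open>Suc i\<close> steps the head is at cell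
  \<open>i\<close>. The total is one step for the opening, one per letter and one for the
  closing.\<close>

lemma run_encoder:
  fixes w :: "'s list"
  defines "tape \<equiv> snd (snd (initial encoder (map Inl w)))"
  shows "run encoder (map Inl w) 0 = (0, 0, tape)"
    and "i \<le> length w \<Longrightarrow> run encoder (map Inl w) (Suc i) = (1, int i, tape)"
    and "run encoder (map Inl w) (Suc (Suc (length w))) = (2, int (length w), tape)"
proof -
  have tape: "tape (int i) = (if i < length w then Inl (w ! i) else Inr 0)" for i
    by (simp add: tape_def initial_def)
  show run0: "run encoder (map Inl w) 0 = (0, 0, tape)"
    by (simp add: run_def tape_def initial_def)
  show run1: "run encoder (map Inl w) (Suc i) = (1, int i, tape)" if "i \<le> length w" for i
    using that
  proof (induction i)
    case 0
    then show ?case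
      using run0 by (simp add: run_def halted_def)
  next
    case (Suc i)
    then have "run encoder (map Inl w) (Suc (Suc i)) = step encoder (1, int i, tape)"
      by (simp add: run_def)
    then show ?case
      \<comment> \<open>Each step writes back the symbol it reads, so the tape stays the
        same.\<close>
      using Suc.prems by (simp add: tape halted_def fun_upd_idem_iff)
  qed
  have "run encoder (map Inl w) (Suc (Suc (length w))) = step encoder (1, int (length w), tape)"
    using run1[of "length w"] by (simp add: run_def)
  then show "run encoder (map Inl w) (Suc (Suc (length w))) = (2, int (length w), tape)"
    by (simp add: tape halted_def fun_upd_idem_iff)
qed

lemma computable_graph: "computable_to_graphs (input_alphabet M) graph"
proof -
  have "transduces encoder (map Inl w) (ntriples [(subj, pred, str_lit (code w))])" for w
  proof -
    define tape where "tape = snd (snd (initial encoder (map Inl w)))"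
    have tape: "tape (int i) = (if i < length w then Inl (w ! i) else Inr 0)" for i
      by (simp add: tape_def initial_def)
    let ?e = "\<lambda>i. emitted encoder (run encoder (map Inl w) i)"
    note run = run_encoder[where w = w, folded tape_def]
    have "concat (map (\<lambda>i. ?e (Suc i)) [0..<length w]) = code w"
    proof -
      have "map (\<lambda>i. ?e (Suc i)) [0..<length w] = map (\<lambda>i. unary (ns (w ! i))) [0..<length w]"
        by (auto simp: run(2) tape halted_def)
      also have "\<dots> = map (\<lambda>a. unary (ns a)) w"
        by (rule nth_equalityI) auto
      finally show ?thesis by (simp add: code_def)
    qed
    moreover have "?e 0 = nt_term subj @ '' '' @ nt_term pred @ '' '' @ [CHR 0x22]"
      by (simp add: run(1) halted_def)
    moreover have "?e (Suc (length w)) =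
        [CHR 0x22, CHR 0x5E, CHR 0x5E] @ ''<'' @ xsd ''string'' @ ''>'' @ '' .'' @ [CHR 0x0A]"
      by (simp add: run(2) tape halted_def)
    \<comment> \<open>Splits the run into opening, letters and closing, whose outputs were computed
      above.\<close>
    moreover have "[0..<Suc (Suc (length w))] = 0 # map Suc [0..<length w] @ [Suc (length w)]"
      by (metis append_Cons map_Suc_upt upt_Suc_append upt_conv_Cons zero_le zero_less_Suc)
    ultimately have "concat (map ?e [0..<Suc (Suc (length w))]) =
        ntriples [(subj, pred, str_lit (code w))]"
      by (simp add: ntriples_def nt_triple_def str_lit_def nt_quoted_def o_def code_def
          nt_char_concat_unary del: upt_Suc)
    moreover have "fst (run encoder (map Inl w) (Suc (Suc (length w)))) = accept encoder"
      by (simp add: run(3))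
    ultimately show ?thesis unfolding transduces_def by metis
  qed
  then have "\<forall>w\<in>lists (input_alphabet M). \<exists>ts. transduces encoder (map Inl w) (ntriples ts) \<and> set ts = graph w"
    by (metis graph_def list.set(1) list.set(2))
  then show ?thesis
    unfolding computable_to_graphs_def
    using turing_machine_encoder by (intro exI[of _ encoder]) simp
qed

end

theorem theorem5p1:
  fixes M :: "('q, 's) turing_machine" and X :: op_interp
  assumes "turing_machine M"
  shows "\<exists>(P :: string procedure) (f :: 's list \<Rightarrow> rdf_graph).
           sparqal_procedure P \<and>
           (\<forall>w\<in>lists (input_alphabet M). is_rdf_graph (f w)) \<and>
           computable_to_graphs (input_alphabet M) f \<and>
           (\<forall>w\<in>lists (input_alphabet M).
              accepts M w \<longleftrightarrow> (\<exists>r. produces X (f w) P r \<and> r \<noteq> []))"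
proof -
  have fin: "finite (states M)" "finite (tape_alphabet M)"
    using assms by (auto simp: turing_machine_def)
  \<comment> \<open>Finiteness supplies the numbers behind the unary codes and the lists for the
    case distinction.\<close>
  obtain nq :: "'q \<Rightarrow> nat" where nq: "inj_on nq (states M)"
    using finite_imp_inj_to_nat_seg[OF fin(1)] by blast
  obtain ns :: "'s \<Rightarrow> nat" where ns: "inj_on ns (tape_alphabet M)"
    using finite_imp_inj_to_nat_seg[OF fin(2)] by blast
  obtain qs as where "set qs = states M" "set as = tape_alphabet M"
    using finite_list fin by metis
  with assms nq ns interpret encoded_machine M nq ns qs as
    by unfold_locales
  show ?thesis
    using sparqal_procedure_simulator graph_is_rdf_graph computable_graph simulator_correct by blast
qed

end
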